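(* Let $K\subset\mathbb{R}^2$ be a convex body with $$|K|\cdot\left|\left((K-K)/2\right)^*\right|\le(1+\varepsilon)\cdot 6,\quad\text{with } \varepsilon>0.$$ Then $\delta_{BM}(K,T)\le 1+87\,\varepsilon$, where $T$ is a triangle.
   Context: $|\cdot|$ denotes area and $\langle\cdot,\cdot\rangle$ the scalar product on $\mathbb{R}^2$. A convex body is a compact convex set with non-empty interior. $K-K=\{x-y:\ x,y\in K\}$. For a convex body $L$ with the origin in its interior the polar is $L^*=\{x\in\mathbb{R}^2:\ \langle x,y\rangle\le 1\ \text{for all } y\in L\}$. For convex bodies $K,L\subset\mathbb{R}^2$ the Banach-Mazur distance is $$\delta_{BM}(K,L)=\min\{\lambda_2/\lambda_1:\ \lambda_1,\lambda_2\in(0,\infty),\ \exists\text{ affinity }A,\ \exists x\in\mathbb{R}^2,\ \lambda_1A(K)\subset L\subset\lambda_2A(K)+x\}.$$ $T$ is any (non-degenerate, closed) triangle; the value of $\delta_{BM}(K,T)$ does not depend on its choice. *)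

theory Defs
  imports "HOL-Analysis.Analysis"
begin

definition convex_body :: "'a::euclidean_space set \<Rightarrow> bool" where
  "convex_body K \<longleftrightarrow> compact K \<and> convex K \<and> interior K \<noteq> {}"

(* On sets the library's infix minus is set difference, so K - K of convex geometry gets a name. *)
definition difference_body :: "'a::euclidean_space set \<Rightarrow> 'a set" where
  "difference_body K = {x - y |x y. x \<in> K \<and> y \<in> K}"

definition polar_body :: "'a::euclidean_space set \<Rightarrow> 'a set" where
  "polar_body L = {x. \<forall>y\<in>L. x \<bullet> y \<le> 1}"

definition affinity :: "('a::euclidean_space \<Rightarrow> 'a) \<Rightarrow> bool" where
  "affinity A \<longleftrightarrow> (\<exists>f c. linear f \<and> bij f \<and> A = (\<lambda>x. f x + c))"

definition bm_ratios :: "'a::euclidean_space set \<Rightarrow> 'a set \<Rightarrow> real set" where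
  "bm_ratios K L = {l\<^sub>2 / l\<^sub>1 |l\<^sub>1 l\<^sub>2. 0 < l\<^sub>1 \<and> 0 < l\<^sub>2 \<and>
     (\<exists>A x. affinity A \<and> (*\<^sub>R) l\<^sub>1 ` A ` K \<subseteq> L \<and> L \<subseteq> (+) x ` (*\<^sub>R) l\<^sub>2 ` A ` K)}"

(* The minimum of the ratios, written as an infimum; for convex bodies the set of ratios is
   nonempty (bm_ratios_nonempty) and bounded below by 0, so Inf has its usual meaning,
   and it agrees with the minimum because the latter is attained. *)
definition banach_mazur :: "'a::euclidean_space set \<Rightarrow> 'a set \<Rightarrow> real" where
  "banach_mazur K L = Inf (bm_ratios K L)"

lemma bm_ratios_nonempty:
  assumes "convex_body K" "convex_body L"
  shows "bm_ratios K L \<noteq> {}"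
proof -
  obtain p where "p \<in> interior K" using assms(1) by (auto simp: convex_body_def)
  then obtain r where r: "r > 0" "cball p r \<subseteq> K" using mem_interior_cball by blast
  obtain q where "q \<in> interior L" using assms(2) by (auto simp: convex_body_def)
  then obtain s where s: "s > 0" "cball q s \<subseteq> L" using mem_interior_cball by blast
  have "bounded K" "bounded L" using assms by (auto simp: convex_body_def compact_imp_bounded)
  then obtain R S where "K \<subseteq> cball p R" "L \<subseteq> cball q S"
    by (metis bounded_any_center mem_cball subsetI)
  then have R: "K \<subseteq> cball p (\<bar>R\<bar> + 1)" and S: "L \<subseteq> cball q (\<bar>S\<bar> + 1)"
    by (fastforce simp: subset_iff)+
  define l where "l = s / (\<bar>R\<bar> + 1)"
  define m where "m = (\<bar>S\<bar> + 1) / r"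
  define A where "A = (\<lambda>x. x + (q /\<^sub>R l - p))"
  have lm: "l > 0" "m > 0" using r s by (auto simp: l_def m_def)
  have "affinity A" unfolding affinity_def A_def
    by (intro exI[of _ id] exI[of _ "q /\<^sub>R l - p"]) (auto simp: linear_id)
  moreover have "(*\<^sub>R) l ` A ` K \<subseteq> L"
  proof safe
    fix x assume "x \<in> K"
    then have "norm (x - p) \<le> \<bar>R\<bar> + 1" using R by (auto simp: dist_norm norm_minus_commute)
    then have "l * norm (x - p) \<le> l * (\<bar>R\<bar> + 1)" using lm by (intro mult_left_mono) auto
    also have "\<dots> = s" by (simp add: l_def)
    finally have "l * norm (x - p) \<le> s" .
    moreover have "l *\<^sub>R A x = q + l *\<^sub>R (x - p)" using lm by (simp add: A_def algebra_simps)
    ultimately have "l *\<^sub>R A x \<in> cball q s" using lm by (simp add: dist_norm)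
    then show "l *\<^sub>R A x \<in> L" using s by blast
  qed
  moreover have "L \<subseteq> (+) (q - (m / l) *\<^sub>R q) ` (*\<^sub>R) m ` A ` K"
  proof
    fix y assume "y \<in> L"
    then have "norm (y - q) \<le> \<bar>S\<bar> + 1" using S by (auto simp: dist_norm norm_minus_commute)
    moreover have "\<bar>S\<bar> + 1 = r * m" using r by (simp add: m_def)
    ultimately have "norm (y - q) / m \<le> r" using lm by (simp add: pos_divide_le_eq)
    then have "p + (y - q) /\<^sub>R m \<in> cball p r"
      using lm by (simp add: dist_norm divide_inverse mult.commute)
    then have "p + (y - q) /\<^sub>R m \<in> K" using r by blast
    moreover have "y = (q - (m / l) *\<^sub>R q) + m *\<^sub>R A (p + (y - q) /\<^sub>R m)"
      using lm by (simp add: A_def algebra_simps divide_inverse)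
    ultimately show "y \<in> (+) (q - (m / l) *\<^sub>R q) ` (*\<^sub>R) m ` A ` K" by blast
  qed
  ultimately have "m / l \<in> bm_ratios K L" using lm unfolding bm_ratios_def by blast
  then show ?thesis by blast
qed

end

theory Submission
  imports Defs
begin

text \<open>
  Every convex body \<open>K\<close> has a circumscribed affinely regular hexagon all of whose sides it touches
  (\<open>hexagonal_frame_exists\<close>).  Half the width of \<open>K\<close> is a norm on linear functionals, and such a hexagon is
  given by functionals \<open>u\<close>, \<open>v\<close> and \<open>v - u\<close> of norm 1 whose strips around \<open>K\<close> have concurrent midlines.  The triples
  of norm 1 form a connected family, and rotating a triple by one step reverses the sign of the deviation from concurrency
  (\<open>balanced_hexagon_exists\<close>).  As the product of areas is invariant under affine maps, the hexagon can be
  taken to be \<open>\<bar>x\<bar>, \<bar>y\<bar>, \<bar>x + y\<bar> \<le> 1\<close>, of area 3.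

  For a body framed in this way both areas are estimated through the depths \<open>x\<^sub>0, \<dots>, x\<^sub>5\<close> at which \<open>K\<close> stays away
  from the vertices of the hexagon.  They satisfy \<open>x\<^sub>i + x\<^sub>i\<^sub>+\<^sub>1 \<le> 1\<close>, so their sum \<open>s\<close> is at most 3.  The part of
  the hexagon lost at a vertex is covered by two triangles spanned by touching points, which gives
  \<open>\<bar>K\<bar> \<ge> 3 - s / 2 + G / 2\<close> with \<open>G = \<Sum> x\<^sub>i min(x\<^sub>i\<^sub>-\<^sub>1, x\<^sub>i\<^sub>+\<^sub>1)\<close> (\<open>measure_framed_ge\<close>).  The polar contains twelve
  explicit points, whose fan of triangles has area at least \<open>36 / (12 - s)\<close> (\<open>measure_polar_framed_ge\<close>).  Already
  without \<open>G\<close> the product of the two bounds is at least 6, with equality only for \<open>s = 3\<close>.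

  If the product is at most \<open>6 (1 + \<epsilon>)\<close>, then \<open>3 - s\<close> and \<open>G\<close> are of order \<open>\<epsilon>\<close>.  The first makes
  neighbouring depths add up to nearly 1, the second makes neighbouring products nearly 0; so the depths
  alternate, up to order \<open>\<epsilon>\<close>, between 0 and 1 (\<open>stability_arithmetic\<close>).  Then \<open>K\<close> comes close to every
  other vertex of the hexagon and is almost contained in the triangle of these vertices, so that it lies between two
  homothetic triangles of nearly the same size (\<open>framed_bm_ratio\<close>).  This argument uses that \<open>\<epsilon>\<close> is small.  From
  \<open>\<epsilon> = 1 / 29\<close> on, the claim follows from the fact that the distance to a triangle never exceeds 4, which an inscribed
  triangle of largest area shows (\<open>bm_ratio_four\<close>).
\<close>

section \<open>Oriented area in the plane\<close>

definition wedge :: "real ^ 2 \<Rightarrow> real ^ 2 \<Rightarrow> real" where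
  "wedge u v = u$1 * v$2 - u$2 * v$1"

lemma wedge_algebra:
  "wedge (u + v) w = wedge u w + wedge v w" "wedge w (u + v) = wedge w u + wedge w v"
  "wedge (u - v) w = wedge u w - wedge v w" "wedge w (u - v) = wedge w u - wedge w v"
  "wedge (r *\<^sub>R u) w = r * wedge u w" "wedge w (r *\<^sub>R u) = r * wedge w u"
  "wedge (- u) w = - wedge u w" "wedge w (- u) = - wedge w u" "wedge u u = 0"
  by (auto simp: wedge_def algebra_simps)

lemma vec2_eq_iff: "(x :: real ^ 2) = y \<longleftrightarrow> x$1 = y$1 \<and> x$2 = y$2"
  by (simp add: vec_eq_iff forall_2)

lemma inner_vec2: "(x :: real ^ 2) \<bullet> y = x$1 * y$1 + x$2 * y$2"
  by (simp add: inner_vec_def UNIV_2)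

lemma parallel_if_wedge_zero:
  assumes "wedge u v = 0" "u \<noteq> 0"
  obtains r where "v = r *\<^sub>R u"
proof -
  have "u $ 1 \<noteq> 0 \<or> u $ 2 \<noteq> 0" using assms(2) by (auto simp: vec2_eq_iff)
  then show thesis
  proof
    assume "u $ 1 \<noteq> 0"
    then show thesis using assms(1)
      by (intro that[of "v$1 / u$1"]) (auto simp: vec2_eq_iff wedge_def field_simps)
  next
    assume "u $ 2 \<noteq> 0"
    then show thesis using assms(1)
      by (intro that[of "v$2 / u$2"]) (auto simp: vec2_eq_iff wedge_def field_simps)
  qed
qed

section \<open>Inscribed affinely regular hexagons of a normed plane\<close>

locale plane_norm =
  fixes N :: "real ^ 2 \<Rightarrow> real"
  assumes triangle: "N (x + y) \<le> N x + N y"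
    and scale: "N (r *\<^sub>R x) = \<bar>r\<bar> * N x"
    and pos: "x \<noteq> 0 \<Longrightarrow> N x > 0"
begin

lemma zero: "N 0 = 0" using scale[of 0 0] by simp

lemma minus: "N (- x) = N x" using scale[of "-1" x] by simp

lemma convex_comb_le:
  assumes "0 \<le> s" "0 \<le> t"
  shows "N (s *\<^sub>R x + t *\<^sub>R y) \<le> s * N x + t * N y"
  using triangle[of "s *\<^sub>R x" "t *\<^sub>R y"] assms by (simp add: scale)

lemma continuous: "continuous_on S N"
proof -
  have "convex_on UNIV N"
    by (rule convex_onI) (use convex_comb_le in \<open>auto simp: convex_UNIV\<close>)
  then show ?thesis
    using convex_on_continuous[of UNIV N] continuous_on_subset by blast
qed

lemma less_one_between:
  assumes y: "N y < 1" and z: "N (y + d *\<^sub>R u) \<le> 1" and c: "0 \<le> c" "c < d"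
  shows "N (y + c *\<^sub>R u) < 1"
proof -
  define t where "t = c / d"
  have t: "0 \<le> t" "t < 1" "t * d = c" using c by (auto simp: t_def)
  have "(1 - t) *\<^sub>R y + t *\<^sub>R (y + d *\<^sub>R u) = y + (t * d) *\<^sub>R u" by (simp add: algebra_simps)
  then have "N (y + c *\<^sub>R u) \<le> (1 - t) * N y + t * N (y + d *\<^sub>R u)"
    using convex_comb_le[of "1 - t" t y "y + d *\<^sub>R u"] t by simp
  also have "\<dots> < (1 - t) * 1 + t * 1"
    using assms t by (intro add_less_le_mono mult_strict_left_mono mult_left_mono) auto
  finally show ?thesis by simp
qed

text \<open>The triangle with vertices 0, \<^term>\<open>u\<close>, \<^term>\<open>v\<close> is equilateral for the norm and has
  sides of length 1; its third vertex lies to the left of \<^term>\<open>u\<close>.\<close>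

definition third_vertex :: "real ^ 2 \<Rightarrow> real ^ 2 \<Rightarrow> bool" where
  "third_vertex u v \<longleftrightarrow> N u = 1 \<and> N v = 1 \<and> N (v - u) = 1 \<and> wedge u v \<ge> 0"

text \<open>The sign condition on the wedge only has to single out one of the two sides of the line through
  \<^term>\<open>u\<close>: a third vertex on that line would be a multiple \<^term>\<open>r *\<^sub>R u\<close>
  with \<open>\<bar>r\<bar> = \<bar>r - 1\<bar> = 1\<close>.\<close>

lemma third_vertex_wedge_pos:
  assumes "third_vertex u v"
  shows "wedge u v > 0"
proof (rule ccontr)
  assume "\<not> wedge u v > 0"
  then have "wedge u v = 0" using assms by (auto simp: third_vertex_def)
  moreover have "u \<noteq> 0" using assms zero by (auto simp: third_vertex_def)
  ultimately obtain r where r: "v = r *\<^sub>R u" using parallel_if_wedge_zero by blast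
  then have "v - u = (r - 1) *\<^sub>R u" by (simp add: algebra_simps)
  then have "\<bar>r\<bar> = 1" "\<bar>r - 1\<bar> = 1"
    using assms r scale[of r u] scale[of "r - 1" u] by (auto simp: third_vertex_def)
  then show False by auto
qed

text \<open>All third vertices over \<^term>\<open>u\<close> lie at the same height above the line through
  \<^term>\<open>u\<close>.  If \<^term>\<open>v\<close> were lower than \<open>v'\<close>, then the unit ball would contain, at the height of
  \<^term>\<open>v\<close>, the points \<open>l v'\<close> and \<open>l (v' - u)\<close> in its interior and, from the diameter
  through \<^term>\<open>u\<close>, a chord strictly longer than \<^term>\<open>u\<close>; so \<^term>\<open>v\<close> and
  \<^term>\<open>v - u\<close>, which differ by \<^term>\<open>u\<close>, cannot both be on the boundary.\<close>

lemma third_vertex_height_unique: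
  assumes v: "third_vertex u v" and v': "third_vertex u v'"
  shows "wedge u v' \<le> wedge u v"
proof (rule ccontr)
  assume "\<not> wedge u v' \<le> wedge u v"
  then have less: "wedge u v < wedge u v'" by simp
  define l where "l = wedge u v / wedge u v'"
  have l: "0 < l" "l < 1"
    using third_vertex_wedge_pos[OF v] less by (auto simp: l_def)
  have "wedge u (v - l *\<^sub>R v') = 0"
    using third_vertex_wedge_pos[OF v'] by (simp add: l_def wedge_algebra)
  moreover have "u \<noteq> 0" using v zero by (auto simp: third_vertex_def)
  ultimately obtain r where r: "v - l *\<^sub>R v' = r *\<^sub>R u" using parallel_if_wedge_zero by blast
  have v1: "v = l *\<^sub>R v' + r *\<^sub>R u" using r by (simp add: algebra_simps)
  have v2: "v - u = l *\<^sub>R (v' - u) + (r - 1 + l) *\<^sub>R u" using v1 by (simp add: algebra_simps)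
  have N: "N u = 1" "N v = 1" "N (v - u) = 1" "N v' = 1" "N (v' - u) = 1"
    using v v' by (auto simp: third_vertex_def)
  have "r \<ge> 0"
  proof (rule ccontr)
    assume "\<not> r \<ge> 0"
    then have "r < 0" by simp
    have "v = l *\<^sub>R v' + (- r) *\<^sub>R (- u)" "v - u = l *\<^sub>R v' + (1 - r) *\<^sub>R (- u)"
      using v1 by (simp_all add: algebra_simps)
    note eqs = this
    have "N (l *\<^sub>R v') < 1" "N (l *\<^sub>R v' + (1 - r) *\<^sub>R (- u)) \<le> 1"
      unfolding eqs(2)[symmetric] using l N by (simp_all add: scale)
    then have "N (l *\<^sub>R v' + (- r) *\<^sub>R (- u)) < 1"
      by (rule less_one_between) (use \<open>r < 0\<close> in auto)
    then have "N v < 1" unfolding eqs(1)[symmetric] .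
    then show False using N by simp
  qed
  moreover have "r \<le> 1 - l"
  proof (rule ccontr)
    assume "\<not> r \<le> 1 - l"
    then have r': "r - 1 + l > 0" by simp
    have v3: "v = l *\<^sub>R (v' - u) + (r + l) *\<^sub>R u" using v1 by (simp add: algebra_simps)
    have "N (l *\<^sub>R (v' - u)) < 1" "N (l *\<^sub>R (v' - u) + (r + l) *\<^sub>R u) \<le> 1"
      unfolding v3[symmetric] using l N by (simp_all add: scale)
    then have "N (l *\<^sub>R (v' - u) + (r - 1 + l) *\<^sub>R u) < 1"
      by (rule less_one_between) (use r' in auto)
    then have "N (v - u) < 1" unfolding v2[symmetric] .
    then show False using N by simp
  qed
  moreover have "1 \<le> l + r"
  proof -
    have "N v \<le> l * N v' + r * N u"
      using convex_comb_le[of l r v' u] l \<open>r \<ge> 0\<close> v1 by simp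
    then show ?thesis using N by simp
  qed
  moreover have "1 \<le> l + (1 - l - r)"
  proof -
    have "v - u = l *\<^sub>R (v' - u) + (1 - l - r) *\<^sub>R (- u)" using v2 by (simp add: algebra_simps)
    then have "N (v - u) \<le> l * N (v' - u) + (1 - l - r) * N (- u)"
      using convex_comb_le[of l "1 - l - r" "v' - u" "- u"] l \<open>r \<le> 1 - l\<close> by simp
    then show ?thesis using N minus by simp
  qed
  ultimately show False using l by linarith
qed

text \<open>Between two third vertices at the same height the norm is at most 1 by convexity.  It is not
  smaller, since the unit vectors \<^term>\<open>v - u\<close> and \<^term>\<open>v\<close>, or
  \<^term>\<open>v + s *\<^sub>R u - u\<close> and \<^term>\<open>v + s *\<^sub>R u\<close>, would then lie on one line and on
  the same side of a point of norm less than 1, against convexity.\<close>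

lemma third_vertex_on_segment:
  assumes v: "third_vertex u v" and v': "third_vertex u (v + s *\<^sub>R u)"
    and s: "0 \<le> r" "r \<le> s"
  shows "third_vertex u (v + r *\<^sub>R u)"
proof (cases "s = 0")
  case True
  then show ?thesis using assms by auto
next
  case False
  then have "s > 0" using s by simp
  have N: "N u = 1" "N v = 1" "N (v - u) = 1" "N (v + s *\<^sub>R u) = 1" "N (v + s *\<^sub>R u - u) = 1"
    using v v' by (auto simp: third_vertex_def)
  have le: "N (w + r *\<^sub>R u) \<le> 1" if "N w = 1" "N (w + s *\<^sub>R u) = 1" for w
  proof -
    have "w + r *\<^sub>R u = (1 - r / s) *\<^sub>R w + (r / s) *\<^sub>R (w + s *\<^sub>R u)"
      using \<open>s > 0\<close> by (simp add: algebra_simps)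
    also have "N \<dots> \<le> (1 - r / s) * N w + (r / s) * N (w + s *\<^sub>R u)"
      using \<open>s > 0\<close> s by (intro convex_comb_le) auto
    finally show ?thesis using that by simp
  qed
  have "N (v + r *\<^sub>R u) = 1"
  proof (rule antisym)
    show "N (v + r *\<^sub>R u) \<le> 1" using le[of v] N by simp
    show "1 \<le> N (v + r *\<^sub>R u)"
    proof (rule ccontr)
      assume "\<not> 1 \<le> N (v + r *\<^sub>R u)"
      then have less: "N (v + r *\<^sub>R u) < 1" by simp
      have eqs: "v = (v + r *\<^sub>R u) + r *\<^sub>R (- u)" "v - u = (v + r *\<^sub>R u) + (r + 1) *\<^sub>R (- u)"
        by (simp_all add: algebra_simps)
      have "N (v + r *\<^sub>R u + (r + 1) *\<^sub>R (- u)) \<le> 1" unfolding eqs(2)[symmetric] using N by simp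
      with less have "N (v + r *\<^sub>R u + r *\<^sub>R (- u)) < 1"
        by (rule less_one_between) (use s in auto)
      then have "N v < 1" by simp
      then show False using N by simp
    qed
  qed
  moreover have "N (v + r *\<^sub>R u - u) = 1"
  proof (rule antisym)
    have eqs: "v + s *\<^sub>R u - u = v - u + s *\<^sub>R u" "v + r *\<^sub>R u - u = v - u + r *\<^sub>R u" by simp_all
    show "N (v + r *\<^sub>R u - u) \<le> 1" unfolding eqs(2)
      by (rule le) (use N in \<open>simp_all only: eqs(1)\<close>)
    show "1 \<le> N (v + r *\<^sub>R u - u)"
    proof (rule ccontr)
      assume "\<not> 1 \<le> N (v + r *\<^sub>R u - u)"
      then have less: "N (v + r *\<^sub>R u - u) < 1" by simp
      have eqs: "v + s *\<^sub>R u - u = (v + r *\<^sub>R u - u) + (s - r) *\<^sub>R u"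
        "v + s *\<^sub>R u = (v + r *\<^sub>R u - u) + (s - r + 1) *\<^sub>R u"
        by (simp_all add: algebra_simps)
      have "N (v + r *\<^sub>R u - u + (s - r + 1) *\<^sub>R u) \<le> 1" unfolding eqs(2)[symmetric] using N by simp
      with less have "N (v + r *\<^sub>R u - u + (s - r) *\<^sub>R u) < 1"
        by (rule less_one_between) (use s in auto)
      then have "N (v + s *\<^sub>R u - u) < 1" unfolding eqs(1)[symmetric] .
      then show False using N by simp
    qed
  qed
  ultimately show ?thesis using v by (auto simp: third_vertex_def wedge_algebra)
qed

lemma convex_third_vertices: "convex {v. third_vertex u v}"
proof (rule convexI; clarify)
  have comb: "third_vertex u (a *\<^sub>R v + b *\<^sub>R (v + s *\<^sub>R u))"
    if "third_vertex u v" "third_vertex u (v + s *\<^sub>R u)" "0 \<le> s" "0 \<le> a" "0 \<le> b" "a + b = 1"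
    for v s and a b :: real
  proof -
    have "a *\<^sub>R v + b *\<^sub>R (v + s *\<^sub>R u) = (a + b) *\<^sub>R v + (b * s) *\<^sub>R u" by (simp add: algebra_simps)
    then have "a *\<^sub>R v + b *\<^sub>R (v + s *\<^sub>R u) = v + (b * s) *\<^sub>R u" using that by simp
    moreover have "b * s \<le> s" using that mult_right_mono[of b 1 s] by simp
    ultimately show ?thesis using third_vertex_on_segment[of u v s "b * s"] that by simp
  qed
  fix x y and a b :: real
  assume x: "third_vertex u x" and y: "third_vertex u y" and ab: "0 \<le> a" "0 \<le> b" "a + b = 1"
  have "wedge u (y - x) = 0"
    using third_vertex_height_unique[OF x y] third_vertex_height_unique[OF y x]
    by (simp add: wedge_algebra)
  moreover have "u \<noteq> 0" using x zero by (auto simp: third_vertex_def)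
  ultimately obtain s where s: "y - x = s *\<^sub>R u" using parallel_if_wedge_zero by blast
  show "third_vertex u (a *\<^sub>R x + b *\<^sub>R y)"
  proof (cases "s \<ge> 0")
    case True
    moreover have "y = x + s *\<^sub>R u" using s by (simp add: algebra_simps)
    ultimately show ?thesis using comb[of x s a b] x y ab by simp
  next
    case False
    moreover have "x = y + (- s) *\<^sub>R u" using s by (simp add: algebra_simps)
    ultimately have "third_vertex u (b *\<^sub>R y + a *\<^sub>R x)" using comb[of y "- s" b a] x y ab by simp
    then show ?thesis by (simp add: add.commute)
  qed
qed

text \<open>Along the half circle from \<^term>\<open>u\<close> to \<^term>\<open>- u\<close> the distance from \<^term>\<open>u\<close>
  passes from 0 to 2, and so takes the value 1.\<close>

lemma third_vertex_exists:
  assumes u: "N u = 1"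
  shows "\<exists>v. third_vertex u v"
proof -
  define w :: "real ^ 2" where "w = vector [- u$2, u$1]"
  define c where "c t = cos t *\<^sub>R u + sin t *\<^sub>R w" for t
  have "u \<noteq> 0" using u zero by auto
  then have "0 < (u$1)\<^sup>2 + (u$2)\<^sup>2" by (auto simp: vec2_eq_iff sum_power2_gt_zero_iff)
  then have uw: "wedge u w > 0" by (simp add: wedge_def w_def power2_eq_square)
  have c0: "c t \<noteq> 0" for t
  proof
    assume "c t = 0"
    then have "wedge u (c t) = 0" "wedge w (c t) = 0" by (auto simp: wedge_def)
    moreover have "wedge u (c t) = sin t * wedge u w" "wedge w (c t) = - (cos t * wedge u w)"
      by (simp_all add: c_def wedge_algebra) (simp add: wedge_def algebra_simps)
    ultimately have "sin t = 0" "cos t = 0" using uw by auto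
    then show False using sin_cos_squared_add[of t] by simp
  qed
  then have Nc: "N (c t) > 0" for t using pos by blast
  define e where "e t = (1 / N (c t)) *\<^sub>R c t" for t
  have Ne: "N (e t) = 1" for t using Nc[of t] by (simp add: e_def scale)
  have contc: "continuous_on {0..pi} c" unfolding c_def by (intro continuous_intros)
  have "continuous_on {0..pi} (\<lambda>t. N (c t))"
    by (rule continuous_on_compose2[OF continuous[of UNIV] contc]) simp
  moreover have "\<forall>t\<in>{0..pi}. N (c t) \<noteq> 0" using Nc by (metis less_irrefl)
  ultimately have conte: "continuous_on {0..pi} e"
    unfolding e_def by (intro continuous_intros contc)
  have "continuous_on {0..pi} (\<lambda>t. N (e t - u))"
    by (intro continuous_on_compose2[OF continuous[of UNIV]] continuous_intros conte) auto
  moreover have "c 0 = u" "c pi = - u" by (auto simp: c_def)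
  then have "e 0 - u = 0" "e pi - u = (- 2) *\<^sub>R u"
    using u by (simp_all add: e_def minus) (simp add: vec2_eq_iff)
  then have "N (e 0 - u) = 0" "N (e pi - u) = 2"
    using u zero scale[of "- 2" u] by auto
  ultimately obtain t where t: "0 \<le> t" "t \<le> pi" "N (e t - u) = 1"
    using IVT'[of "\<lambda>t. N (e t - u)" 0 1 pi] by auto
  have "wedge u (c t) = sin t * wedge u w" by (simp add: c_def wedge_algebra)
  then have "wedge u (e t) \<ge> 0"
    using t uw Nc[of t] sin_ge_zero[of t] by (simp add: e_def wedge_algebra)
  then show ?thesis using t Ne u by (auto simp: third_vertex_def)
qed

text \<open>A third vertex spans an affinely regular hexagon inscribed in the unit circle; this is the
  passage from one side of that hexagon to the next.\<close>

lemma third_vertex_next: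
  assumes "third_vertex u v"
  shows "third_vertex v (v - u)"
  using assms by (auto simp: third_vertex_def minus wedge_algebra wedge_def algebra_simps)

lemma unit_circle_image:
  shows "continuous_on (sphere 0 1) (\<lambda>x. (1 / N x) *\<^sub>R x)"
    and "(\<lambda>x. (1 / N x) *\<^sub>R x) ` sphere 0 1 = {u. N u = 1}"
proof -
  have "\<forall>x\<in>sphere 0 1. N x \<noteq> 0" using pos by (metis less_irrefl mem_sphere_0 norm_zero zero_neq_one)
  then show "continuous_on (sphere 0 1) (\<lambda>x. (1 / N x) *\<^sub>R x)"
    by (intro continuous_intros continuous)
  show "(\<lambda>x. (1 / N x) *\<^sub>R x) ` sphere 0 1 = {u. N u = 1}"
  proof (intro equalityI subsetI)
    fix u assume u: "u \<in> {u. N u = 1}"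
    then have "u \<noteq> 0" using zero by auto
    then have "u = (1 / N ((1 / norm u) *\<^sub>R u)) *\<^sub>R ((1 / norm u) *\<^sub>R u)"
      using u by (simp add: scale)
    moreover have "(1 / norm u) *\<^sub>R u \<in> sphere 0 1" using \<open>u \<noteq> 0\<close> by simp
    ultimately show "u \<in> (\<lambda>x. (1 / N x) *\<^sub>R x) ` sphere 0 1" by (rule image_eqI)
  next
    fix u assume "u \<in> (\<lambda>x. (1 / N x) *\<^sub>R x) ` sphere 0 1"
    then obtain x where x: "norm x = 1" "u = (1 / N x) *\<^sub>R x" by auto
    then have "x \<noteq> 0" by auto
    then have "N x > 0" by (rule pos)
    then show "u \<in> {u. N u = 1}" using x by (simp add: scale)
  qed
qed

lemma compact_unit_circle: "compact {u. N u = 1}"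
  using compact_continuous_image[OF unit_circle_image(1) compact_sphere] unit_circle_image(2) by simp

lemma connected_unit_circle: "connected {u. N u = 1}"
  using connected_continuous_image[OF unit_circle_image(1) connected_sphere] unit_circle_image(2) by simp

text \<open>For a norm that is not strictly convex the third vertex is not a function of
  \<^term>\<open>u\<close>, so no path can be followed.  Projecting the compact set of all pairs to the connected unit circle is
  instead a closed map with convex fibres, and such a map has a connected domain.\<close>

lemma connected_third_vertex_pairs: "connected {(u, v). third_vertex u v}"
proof -
  let ?Z = "{(u, v). third_vertex u v}" and ?C = "{u. N u = 1}"
  have fst: "fst ` ?Z = ?C"
    using third_vertex_exists by (force simp: third_vertex_def image_iff)
  have "closed ?Z"
  proof -
    have "?Z = {p. N (fst p) = 1} \<inter> {p. N (snd p) = 1} \<inter> {p. N (snd p - fst p) = 1}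
        \<inter> {p. wedge (fst p) (snd p) \<ge> 0}"
      by (auto simp: third_vertex_def)
    moreover have "continuous_on UNIV (\<lambda>p. N (fst p))" "continuous_on UNIV (\<lambda>p. N (snd p))"
      "continuous_on UNIV (\<lambda>p. N (snd p - fst p))"
      by (rule continuous_on_compose2[OF continuous[of UNIV]]; (simp | intro continuous_intros))+
    moreover have "continuous_on UNIV (\<lambda>p. wedge (fst p) (snd p))"
      unfolding wedge_def by (intro continuous_intros)
    ultimately show ?thesis
      by (simp only:) (intro closed_Int closed_Collect_eq closed_Collect_le continuous_on_const)
  qed
  moreover have "?Z = (?C \<times> ?C) \<inter> ?Z" by (auto simp: third_vertex_def)
  ultimately have "compact ?Z"
    using compact_unit_circle by (metis compact_Int_closed compact_Times)
  have "connected (?Z \<inter> fst -` ?C)"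
  proof (rule connected_closed_monotone_preimage[OF _ fst])
    show "continuous_on ?Z fst" by (intro continuous_intros)
    show "closedin (top_of_set ?C) (fst ` U)" if "closedin (top_of_set ?Z) U" for U
      by (rule Abstract_Topology_2.continuous_imp_closed_map[OF that _ fst \<open>compact ?Z\<close>])
        (intro continuous_intros)
    show "connected (?Z \<inter> fst -` {u})" for u
    proof -
      have "?Z \<inter> fst -` {u} = {u} \<times> {v. third_vertex u v}" by auto
      then show ?thesis using convex_third_vertices by (simp add: connected_Times convex_connected)
    qed
    show "connected ?C" by (rule connected_unit_circle)
  qed auto
  moreover have "?Z \<inter> fst -` ?C = ?Z" by (auto simp: third_vertex_def)
  ultimately show ?thesis by simp
qed

text \<open>The defect \<^term>\<open>m u + m (v - u) - m v\<close> changes sign when the hexagon is rotated by one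
  side, because \<^term>\<open>m\<close> is odd.  As the hexagons form a connected family, the defect vanishes for one of them.\<close>

lemma balanced_hexagon_exists:
  assumes m: "continuous_on UNIV m" and odd: "\<And>x. m (- x) = - (m x :: real)"
  shows "\<exists>u v. third_vertex u v \<and> m u + m (v - u) = m v"
proof -
  let ?Z = "{(u, v). third_vertex u v}"
  define f where "f = (\<lambda>p. m (fst p) + m (snd p - fst p) - m (snd p))"
  have contf: "continuous_on ?Z f"
    unfolding f_def
    by (intro continuous_intros continuous_on_compose2[OF m]) auto
  have "\<exists>u::real^2. u \<noteq> 0" by (intro exI[of _ "axis 1 1"]) (simp add: axis_eq_0_iff)
  then obtain u :: "real^2" where "u \<noteq> 0" by blast
  then have "N ((1 / N u) *\<^sub>R u) = 1" using pos[of u] by (simp add: scale)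
  then obtain u v where uv: "third_vertex u v" using third_vertex_exists by blast
  have f2: "f (v, v - u) = - f (u, v)"
    using odd[of u] by (simp add: f_def)
  have "connected (f ` ?Z)" using connected_continuous_image[OF contf connected_third_vertex_pairs] .
  moreover have "f (u, v) \<in> f ` ?Z" using uv by (intro imageI) simp
  moreover have "f (v, v - u) \<in> f ` ?Z" using third_vertex_next[OF uv] by (intro imageI) simp
  then have "- f (u, v) \<in> f ` ?Z" using f2 by simp
  ultimately have "0 \<in> f ` ?Z"
    using connectedD_interval[of "f ` ?Z" "- f (u, v)" "f (u, v)" 0]
      connectedD_interval[of "f ` ?Z" "f (u, v)" "- f (u, v)" 0] by linarith
  then obtain x y where "third_vertex x y" "f (x, y) = 0" by fastforce
  then show ?thesis by (intro exI[of _ x] exI[of _ y]) (simp add: f_def)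
qed

end

section \<open>Area bounds from a fan of triangles\<close>

lemma content_triangle_wedge:
  "measure lebesgue (convex hull {a, a + p, a + q}) = \<bar>wedge p q\<bar> / 2"
proof -
  have "compact (convex hull {a, a + p, a + q})"
    by (simp add: finite_imp_compact_convex_hull)
  then have "measure lebesgue (convex hull {a, a + p, a + q}) = measure lborel (convex hull {a, a + p, a + q})"
    by (simp add: borel_compact)
  then show ?thesis
    by (simp add: content_triangle wedge_def abs_minus_commute algebra_simps)
qed

lemma lmeasurable_triangle: "convex hull {a, b, c :: real ^ 2} \<in> lmeasurable"
  by (simp add: finite_imp_compact_convex_hull lmeasurable_compact)

lemma open_cone_wedge:
  "open {x. wedge p x > 0 \<and> wedge x q > 0}"
  unfolding wedge_def by (intro open_Collect_conj open_Collect_less continuous_intros)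

lemma measure_le_modulo_negligible:
  assumes "T \<subseteq> A \<union> Z1 \<union> Z2" "negligible (Z1 \<union> Z2)" "A \<in> lmeasurable" "T \<in> lmeasurable"
  shows "measure lebesgue T \<le> measure lebesgue A"
proof -
  have Z: "Z1 \<union> Z2 \<in> lmeasurable" using assms(2) by (rule negligible_imp_measurable)
  have "measure lebesgue T \<le> measure lebesgue (A \<union> (Z1 \<union> Z2))"
    using assms Z
    by (intro measure_mono_fmeasurable fmeasurable.Un[OF _ Z]) (auto simp del: negligible_Un_eq)
  also have "\<dots> \<le> measure lebesgue A + measure lebesgue (Z1 \<union> Z2)"
    using assms fmeasurableD[OF Z] by (intro measure_Un_le) auto
  also have "measure lebesgue (Z1 \<union> Z2) = 0" using assms(2) by (rule negligible_imp_measure0)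
  finally show ?thesis by simp
qed

text \<open>The cone is taken open so that neighbouring cones are disjoint; this loses only the two
  bounding lines of the triangle, which have area 0.\<close>

lemma triangle_in_cone_area:
  assumes S: "convex S" "S \<in> lmeasurable" "0 \<in> S" "p \<in> S" "q \<in> S" and pq: "wedge p q > 0"
  shows "wedge p q / 2 \<le> measure lebesgue (S \<inter> {x. wedge p x > 0 \<and> wedge x q > 0})"
proof -
  let ?T = "convex hull {0, 0 + p, 0 + q}"
  let ?C = "{x. wedge p x > 0 \<and> wedge x q > 0}"
  have meas: "measure lebesgue ?T = wedge p q / 2"
    using content_triangle_wedge[of 0 p q] pq by simp
  have "?T \<subseteq> (?T \<inter> ?C) \<union> {x. wedge p x = 0} \<union> {x. wedge x q = 0}"
  proof
    fix x assume x: "x \<in> ?T"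
    then obtain b c where "0 \<le> b" "0 \<le> c" "x = b *\<^sub>R p + c *\<^sub>R q"
      unfolding convex_hull_3 by fastforce
    then have "wedge p x = c * wedge p q" "wedge x q = b * wedge p q" "0 \<le> b" "0 \<le> c"
      by (auto simp: wedge_algebra)
    then have "wedge p x \<ge> 0" "wedge x q \<ge> 0" using pq by auto
    then show "x \<in> (?T \<inter> ?C) \<union> {x. wedge p x = 0} \<union> {x. wedge x q = 0}"
      using x by fastforce
  qed
  moreover have "negligible {x. wedge p x = 0}" "negligible {x. wedge x q = 0}"
  proof -
    have "p \<noteq> 0" "q \<noteq> 0" using pq by (auto simp: wedge_def)
    then have "vector [- p$2, p$1] \<noteq> (0 :: real^2)" "vector [q$2, - q$1] \<noteq> (0 :: real^2)"
      by (auto simp: vec2_eq_iff)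
    then have "negligible {x. (vector [- p$2, p$1] :: real^2) \<bullet> x = 0}"
      "negligible {x. (vector [q$2, - q$1] :: real^2) \<bullet> x = 0}"
      by (auto intro: negligible_hyperplane)
    moreover have "(vector [- p$2, p$1] :: real^2) \<bullet> x = wedge p x"
      "(vector [q$2, - q$1] :: real^2) \<bullet> x = wedge x q" for x
      by (simp_all add: inner_vec2 wedge_def)
    ultimately show "negligible {x. wedge p x = 0}" "negligible {x. wedge x q = 0}" by simp_all
  qed
  then have "negligible ({x. wedge p x = 0} \<union> {x. wedge x q = 0})" by simp
  moreover have TC: "?T \<inter> ?C \<in> lmeasurable"
    using lmeasurable_triangle[of 0 "0 + p" "0 + q"] open_cone_wedge[of p q]
    by (simp add: fmeasurable_Int_fmeasurable lborelD_Collect)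
  ultimately have "measure lebesgue ?T \<le> measure lebesgue (?T \<inter> ?C)"
    by (rule measure_le_modulo_negligible) (rule lmeasurable_triangle)
  also have "?T \<subseteq> S" using S by (intro hull_minimal) auto
  then have "measure lebesgue (?T \<inter> ?C) \<le> measure lebesgue (S \<inter> ?C)"
    using TC S open_cone_wedge[of p q]
    by (intro measure_mono_fmeasurable) (auto simp: fmeasurableD fmeasurable_Int_fmeasurable)
  finally show ?thesis using meas by simp
qed

lemma sum_measure_disjoint_le:
  assumes "finite I" "S \<in> lmeasurable" "\<And>i. i \<in> I \<Longrightarrow> A i \<in> sets lebesgue"
    and "disjoint_family_on A I"
  shows "(\<Sum>i\<in>I. measure lebesgue (S \<inter> A i)) \<le> measure lebesgue S"
proof -
  have m: "S \<inter> A i \<in> lmeasurable" if "i \<in> I" for i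
    using assms that by (intro fmeasurable_Int_fmeasurable) auto
  have "disjoint_family_on (\<lambda>i. S \<inter> A i) I" using assms(4) by (fastforce simp: disjoint_family_on_def)
  moreover have "emeasure lebesgue (S \<inter> A i) \<noteq> \<infinity>" if "i \<in> I" for i
    using fmeasurableD2[OF m[OF that]] by simp
  ultimately have "(\<Sum>i\<in>I. measure lebesgue (S \<inter> A i)) = measure lebesgue (\<Union>i\<in>I. S \<inter> A i)"
    using assms(1) m by (intro measure_finite_Union[symmetric]) auto
  also have "\<dots> \<le> measure lebesgue S"
    using assms m by (intro measure_mono_fmeasurable) auto
  finally show ?thesis .
qed

text \<open>The outer normals of the sides of the hexagon \<open>\<bar>x\<bar>, \<bar>y\<bar>, \<bar>x + y\<bar> \<le> 1\<close>, counterclockwise and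
  with period 6.  The recursion expresses that the hexagon is affinely regular.\<close>

fun hex_normal :: "nat \<Rightarrow> real ^ 2" where
  "hex_normal 0 = vector [1, 1]"
| "hex_normal (Suc 0) = vector [0, 1]"
| "hex_normal (Suc (Suc i)) = hex_normal (Suc i) - hex_normal i"

text \<open>The six normals with the six bisecting directions put between them.  Consecutive members of this
  list of twelve span parallelograms of area 1.\<close>

definition hex_direction :: "nat \<Rightarrow> real ^ 2" where
  "hex_direction i = (if even i then hex_normal (i div 2) else hex_normal (i div 2) + hex_normal (Suc (i div 2)))"

lemma hex_direction_simps:
  "hex_direction 0 = vector [1, 1]" "hex_direction (Suc 0) = vector [1, 2]" "hex_direction (Suc (Suc 0)) = vector [0, 1]"
  "hex_direction (Suc (Suc (Suc 0))) = vector [-1, 1]"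
  "hex_direction (Suc (Suc (Suc (Suc i)))) = hex_direction (Suc (Suc i)) - hex_direction i"
  by (auto simp: hex_direction_def vec2_eq_iff)

lemma fan_area:
  fixes S :: "(real ^ 2) set" and r :: "nat \<Rightarrow> real"
  assumes S: "convex S" "S \<in> lmeasurable" "0 \<in> S"
    and r: "\<And>i. i < 13 \<Longrightarrow> r i > 0 \<and> r i *\<^sub>R hex_direction i \<in> S"
  shows "(\<Sum>i<12. r i * r (Suc i)) / 2 \<le> measure lebesgue S"
proof -
  define C where "C i = {x. wedge (hex_direction i) x > 0 \<and> wedge x (hex_direction (Suc i)) > 0}" for i
  have sets: "C i \<in> sets lebesgue" for i
    using open_cone_wedge unfolding C_def by (simp add: borel_open)
  have "\<forall>j<12. \<forall>i<j. x \<in> C i \<longrightarrow> x \<notin> C j" for x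
    by (simp add: eval_nat_numeral All_less_Suc)
      (intro conjI impI; simp add: C_def hex_direction_simps wedge_def)
  then have "C i \<inter> C j = {}" if "i < j" "j < 12" for i j
    using that by blast
  then have disj: "disjoint_family_on C {..<12}"
    unfolding disjoint_family_on_def by (metis Int_commute lessThan_iff nat_neq_iff)
  have w: "wedge (hex_direction i) (hex_direction (Suc i)) = 1" if "i < 12" for i
    using that by (auto simp: eval_nat_numeral less_Suc_eq hex_direction_simps wedge_def)
  have le: "r i * r (Suc i) / 2 \<le> measure lebesgue (S \<inter> C i)" if "i < 12" for i
  proof -
    have ri: "r i > 0" "r i *\<^sub>R hex_direction i \<in> S" "r (Suc i) > 0" "r (Suc i) *\<^sub>R hex_direction (Suc i) \<in> S"
      using r[of i] r[of "Suc i"] that by auto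
    have "wedge (r i *\<^sub>R hex_direction i) (r (Suc i) *\<^sub>R hex_direction (Suc i)) = r i * r (Suc i)"
      using w[OF that] by (simp add: wedge_algebra)
    moreover have "{x. 0 < wedge (r i *\<^sub>R hex_direction i) x \<and> 0 < wedge x (r (Suc i) *\<^sub>R hex_direction (Suc i))} = C i"
      using ri by (auto simp: C_def wedge_algebra zero_less_mult_iff)
    ultimately show ?thesis
      using triangle_in_cone_area[OF S ri(2,4)] ri by simp
  qed
  have "(\<Sum>i<12. r i * r (Suc i)) / 2 = (\<Sum>i<12. r i * r (Suc i) / 2)"
    by (simp add: sum_divide_distrib)
  also have "\<dots> \<le> (\<Sum>i<12. measure lebesgue (S \<inter> C i))"
    using le by (intro sum_mono) auto
  also have "\<dots> \<le> measure lebesgue S"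
    using sum_measure_disjoint_le[OF _ S(2) sets disj] by simp
  finally show ?thesis .
qed

lemma sum_consecutive_pairs: "(\<Sum>i<2 * n. f i) = (\<Sum>i<n. f (2 * i) + (f (Suc (2 * i)) :: real))"
  by (induction n) (auto simp: algebra_simps)

text \<open>Stated for radii along the normals and along the bisectors, since these are the points known in
  both applications: the hexagon itself, and the polar of a body inscribed in it.\<close>

lemma hexagonal_fan_area:
  fixes S :: "(real ^ 2) set" and r \<rho> :: "nat \<Rightarrow> real"
  assumes S: "convex S" "S \<in> lmeasurable" "0 \<in> S"
    and r: "\<And>i. i \<le> 6 \<Longrightarrow> r i > 0 \<and> r i *\<^sub>R hex_normal i \<in> S"
    and \<rho>: "\<And>i. i < 6 \<Longrightarrow> \<rho> i > 0 \<and> \<rho> i *\<^sub>R (hex_normal i + hex_normal (Suc i)) \<in> S"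
  shows "(\<Sum>i<6. \<rho> i * (r i + r (Suc i))) / 2 \<le> measure lebesgue S"
proof -
  define R where "R i = (if even i then r (i div 2) else \<rho> (i div 2))" for i
  have "R i > 0 \<and> R i *\<^sub>R hex_direction i \<in> S" if "i < 13" for i
    using r[of "i div 2"] \<rho>[of "i div 2"] that by (auto simp: R_def hex_direction_def elim!: oddE)
  from fan_area[OF S this] show ?thesis
    using sum_consecutive_pairs[of "\<lambda>i. R i * R (Suc i)" 6] by (simp add: R_def algebra_simps)
qed

section \<open>Banach-Mazur distance to triangles\<close>

lemma wedge_nonzero_if_not_collinear:
  assumes "\<not> collinear {a, b, c :: real ^ 2}"
  shows "wedge (b - a) (c - a) \<noteq> 0"
proof
  assume w: "wedge (b - a) (c - a) = 0"
  have "collinear {b, a, c}"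
  proof (cases "b - a = 0")
    case False
    then obtain r where "c - a = r *\<^sub>R (b - a)" using parallel_if_wedge_zero[OF w] by blast
    then have "collinear {0, b - a, c - a}" unfolding collinear_lemma by blast
    then show ?thesis by (subst collinear_3) simp_all
  qed (simp add: collinear_3)
  then show False using assms by (simp add: insert_commute)
qed

lemma linear_bij_of_bases:
  assumes uv: "wedge u v \<noteq> 0" and xy: "wedge x y \<noteq> 0"
  shows "\<exists>f. linear f \<and> bij f \<and> f u = x \<and> f v = y"
proof -
  define f where "f z = (wedge z v / wedge u v) *\<^sub>R x + (wedge u z / wedge u v) *\<^sub>R y" for z
  have lin: "linear f"
    by (intro linearI) (simp_all add: f_def wedge_algebra algebra_simps add_divide_distrib)
  have "inj f"
  proof (rule linear_injective_0[OF lin, THEN iffD2], intro allI impI)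
    fix z assume "f z = 0"
    then have "wedge (f z) y = 0" "wedge x (f z) = 0" by (simp_all add: wedge_def)
    then have "wedge z v = 0" "wedge u z = 0"
      using uv xy by (simp_all add: f_def wedge_algebra)
    then have "z$1 * wedge u v = 0" "z$2 * wedge u v = 0"
      by (simp_all add: wedge_def) algebra+
    then show "z = 0" using uv by (simp add: vec2_eq_iff)
  qed
  then have "bij f" using linear_injective_imp_surjective[OF lin] by (simp add: bij_def)
  moreover have "f u = x" "f v = y" using uv by (simp_all add: f_def wedge_algebra)
  ultimately show ?thesis using lin by blast
qed

text \<open>The affine map that carries the outer triangle to the given one carries the inner homothetic copy
  to a homothetic copy.\<close>

lemma bm_ratios_sandwiched:
  assumes K: "convex K" and abc: "\<not> collinear {a, b, c :: real ^ 2}" and pqr: "wedge (q - p) (r - p) \<noteq> 0"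
    and outer: "K \<subseteq> convex hull {p, q, r}" and \<rho>: "\<rho> > 0"
    and inner: "s + \<rho> *\<^sub>R p \<in> K" "s + \<rho> *\<^sub>R q \<in> K" "s + \<rho> *\<^sub>R r \<in> K"
  shows "1 / \<rho> \<in> bm_ratios K (convex hull {a, b, c})"
proof -
  obtain f where f: "linear f" "bij f" "f (q - p) = b - a" "f (r - p) = c - a"
    using linear_bij_of_bases[OF pqr wedge_nonzero_if_not_collinear[OF abc]] by blast
  define t where "t = a - f p"
  define A where "A x = f x + t" for x
  have A: "affinity A" unfolding affinity_def A_def using f by blast
  have Apqr: "A p = a" "A q = b" "A r = c"
    using f by (auto simp: A_def t_def linear_diff algebra_simps)
  have "A ` (convex hull {p, q, r}) = (+) t ` f ` (convex hull {p, q, r})"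
    by (auto simp: A_def image_image add.commute)
  also have "\<dots> = convex hull ((+) t ` f ` {p, q, r})"
    by (simp only: convex_hull_linear_image[OF f(1)] convex_hull_translation)
  also have "(+) t ` f ` {p, q, r} = A ` {p, q, r}"
    by (auto simp: A_def add.commute)
  also have "A ` {p, q, r} = {a, b, c}" using Apqr by simp
  finally have hull: "A ` (convex hull {p, q, r}) = convex hull {a, b, c}" .
  have "convex hull {a, b, c} \<subseteq> (+) (t - (1/\<rho>) *\<^sub>R (f s + t)) ` (*\<^sub>R) (1/\<rho>) ` A ` K"
  proof
    fix y assume "y \<in> convex hull {a, b, c}"
    then obtain z where z: "z \<in> convex hull {p, q, r}" "y = A z" using hull by auto
    then obtain u v w where uvw: "0 \<le> u" "0 \<le> v" "0 \<le> w" "u + v + w = 1"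
      "z = u *\<^sub>R p + v *\<^sub>R q + w *\<^sub>R r"
      unfolding convex_hull_3 by blast
    have "convex hull {s + \<rho> *\<^sub>R p, s + \<rho> *\<^sub>R q, s + \<rho> *\<^sub>R r} \<subseteq> K"
      using inner K by (intro hull_minimal) auto
    moreover have "u *\<^sub>R (s + \<rho> *\<^sub>R p) + v *\<^sub>R (s + \<rho> *\<^sub>R q) + w *\<^sub>R (s + \<rho> *\<^sub>R r)
        \<in> convex hull {s + \<rho> *\<^sub>R p, s + \<rho> *\<^sub>R q, s + \<rho> *\<^sub>R r}"
      unfolding convex_hull_3 using uvw by blast
    ultimately have "u *\<^sub>R (s + \<rho> *\<^sub>R p) + v *\<^sub>R (s + \<rho> *\<^sub>R q) + w *\<^sub>R (s + \<rho> *\<^sub>R r) \<in> K" by blast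
    also have "u *\<^sub>R (s + \<rho> *\<^sub>R p) + v *\<^sub>R (s + \<rho> *\<^sub>R q) + w *\<^sub>R (s + \<rho> *\<^sub>R r)
        = (u + v + w) *\<^sub>R s + \<rho> *\<^sub>R z"
      using uvw(5) by (simp add: algebra_simps)
    finally have "s + \<rho> *\<^sub>R z \<in> K" using uvw by simp
    moreover have "y = (t - (1/\<rho>) *\<^sub>R (f s + t)) + (1/\<rho>) *\<^sub>R A (s + \<rho> *\<^sub>R z)"
      using \<rho> z(2) f(1) by (simp add: A_def linear_add linear_cmul algebra_simps)
    ultimately show "y \<in> (+) (t - (1/\<rho>) *\<^sub>R (f s + t)) ` (*\<^sub>R) (1/\<rho>) ` A ` K" by blast
  qed
  moreover have "(*\<^sub>R) 1 ` A ` K \<subseteq> convex hull {a, b, c}" using outer hull by auto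
  ultimately have "(1 / \<rho>) / 1 \<in> bm_ratios K (convex hull {a, b, c})"
    unfolding bm_ratios_def using A \<rho> by (intro CollectI exI[of _ 1] exI[of _ "1 / \<rho>"]) auto
  then show ?thesis by simp
qed

lemma bm_ratios_affinity_image:
  assumes "affinity g"
  shows "bm_ratios (g ` K) L \<subseteq> bm_ratios K L"
proof
  fix r assume "r \<in> bm_ratios (g ` K) L"
  then obtain l1 l2 A x where r: "r = l2 / l1" "0 < l1" "0 < l2" "affinity A"
    "(*\<^sub>R) l1 ` A ` g ` K \<subseteq> L" "L \<subseteq> (+) x ` (*\<^sub>R) l2 ` A ` g ` K"
    unfolding bm_ratios_def by blast
  have "affinity (A \<circ> g)"
  proof -
    obtain f c where f: "linear f" "bij f" "A = (\<lambda>x. f x + c)" using r(4) by (auto simp: affinity_def)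
    obtain h d where h: "linear h" "bij h" "g = (\<lambda>x. h x + d)" using assms by (auto simp: affinity_def)
    have "linear (f \<circ> h)" "bij (f \<circ> h)" using f h by (auto intro: linear_compose bij_comp)
    moreover have "A \<circ> g = (\<lambda>x. (f \<circ> h) x + (f d + c))"
      using f h by (auto simp: linear_add)
    ultimately show ?thesis unfolding affinity_def by blast
  qed
  moreover have "A ` g ` K = (A \<circ> g) ` K" by (simp add: image_comp)
  ultimately show "r \<in> bm_ratios K L"
    unfolding bm_ratios_def using r(1-3,5,6)
    by (intro CollectI exI[of _ l1] exI[of _ l2] conjI exI[of _ "A \<circ> g"] exI[of _ x]) simp_all
qed

lemma banach_mazur_le:
  assumes "r \<in> bm_ratios K L"
  shows "banach_mazur K L \<le> r"
  unfolding banach_mazur_def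
proof (rule cInf_lower[OF assms])
  show "bdd_below (bm_ratios K L)"
    by (rule bdd_belowI[of _ 0]) (auto simp: bm_ratios_def)
qed

text \<open>A point outside \<^term>\<open>K\<close> is strictly separated from \<^term>\<open>K\<close> by a linear function.  Let \<open>V\<^sub>m\<close> be
  the vertex where it is smallest, and \<open>R\<close> the difference between its extreme values at the three vertices.  The
  perturbed copy of \<open>V\<^sub>m\<close> raises the minimum by at most \<open>2 \<sigma> R\<close>, and a point whose barycentric coordinates are all at
  least \<open>2 \<sigma>\<close> lies at least that far above it.\<close>

lemma perturbed_triangle_contains:
  fixes V1 V2 V3 :: "'a::euclidean_space"
  assumes K: "convex K" "closed K" and \<sigma>: "0 \<le> \<sigma>"
    and P: "x1 + y1 + z1 = 1" "x1 *\<^sub>R V1 + y1 *\<^sub>R V2 + z1 *\<^sub>R V3 \<in> K" "x1 \<ge> 1 - \<sigma>" "y1 \<ge> - \<sigma>" "z1 \<ge> - \<sigma>"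
      "x2 + y2 + z2 = 1" "x2 *\<^sub>R V1 + y2 *\<^sub>R V2 + z2 *\<^sub>R V3 \<in> K" "x2 \<ge> - \<sigma>" "y2 \<ge> 1 - \<sigma>" "z2 \<ge> - \<sigma>"
      "x3 + y3 + z3 = 1" "x3 *\<^sub>R V1 + y3 *\<^sub>R V2 + z3 *\<^sub>R V3 \<in> K" "x3 \<ge> - \<sigma>" "y3 \<ge> - \<sigma>" "z3 \<ge> 1 - \<sigma>"
    and g: "g1 + g2 + g3 = 1" "g1 \<ge> 2 * \<sigma>" "g2 \<ge> 2 * \<sigma>" "g3 \<ge> 2 * \<sigma>"
  shows "g1 *\<^sub>R V1 + g2 *\<^sub>R V2 + g3 *\<^sub>R V3 \<in> K"
proof (rule ccontr)
  assume "\<not> ?thesis"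
  then obtain n d where n: "n \<bullet> (g1 *\<^sub>R V1 + g2 *\<^sub>R V2 + g3 *\<^sub>R V3) < d" "\<And>x. x \<in> K \<Longrightarrow> n \<bullet> x > d"
    using separating_hyperplane_closed_point[OF K] by blast
  define f1 f2 f3 where f: "f1 = n \<bullet> V1" "f2 = n \<bullet> V2" "f3 = n \<bullet> V3"
  \<comment> \<open>Here \<open>p \<le> q \<le> r\<close> are the sorted values of the separating function at the \<open>V\<^sub>i\<close>; the perturbed vertex used is
     that of the smallest one.\<close>
  have key: False
    if "x + y + z = 1" "x \<ge> 1 - \<sigma>" "y \<ge> - \<sigma>" "z \<ge> - \<sigma>" "a + b + c = 1" "a \<ge> 2 * \<sigma>" "b \<ge> 2 * \<sigma>" "c \<ge> 2 * \<sigma>"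
      "p \<le> q" "q \<le> r" "a * p + b * q + c * r < x * p + y * q + z * r" for x y z a b c p q r :: real
  proof -
    have x: "x = 1 - y - z" and a: "a = 1 - b - c" using that by auto
    have "(y + z) * (r - p) \<le> \<sigma> * (r - p)" "0 \<le> \<sigma> * (q - p)"
      "0 \<le> b * (q - p)" "(2 * \<sigma>) * (r - p) \<le> c * (r - p)"
      using that \<sigma> by (auto intro!: mult_right_mono mult_nonneg_nonneg)
    moreover have "(- y) * (r - q) \<le> \<sigma> * (r - q)"
      by (rule mult_right_mono) (use that in auto)
    ultimately show False using that(11) unfolding x a by (simp add: algebra_simps)
  qed
  have less: "g1 * f1 + g2 * f2 + g3 * f3 < x * f1 + y * f2 + z * f3"
    if "x *\<^sub>R V1 + y *\<^sub>R V2 + z *\<^sub>R V3 \<in> K" for x y z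
    using n(1) n(2)[OF that] by (simp add: f inner_add_right)
  note less = less[OF P(2)] less[OF P(7)] less[OF P(12)]
  consider "f1 \<le> f2" "f2 \<le> f3" | "f1 \<le> f3" "f3 \<le> f2" | "f2 \<le> f1" "f1 \<le> f3"
    | "f2 \<le> f3" "f3 \<le> f1" | "f3 \<le> f1" "f1 \<le> f2" | "f3 \<le> f2" "f2 \<le> f1" by linarith
  then show False
  proof cases
    case 1 then show False using key[of x1 y1 z1 g1 g2 g3 f1 f2 f3] P g less by linarith
  next
    case 2 then show False using key[of x1 z1 y1 g1 g3 g2 f1 f3 f2] P g less by linarith
  next
    case 3 then show False using key[of y2 x2 z2 g2 g1 g3 f2 f1 f3] P g less by linarith
  next
    case 4 then show False using key[of y2 z2 x2 g2 g3 g1 f2 f3 f1] P g less by linarith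
  next
    case 5 then show False using key[of z3 x3 y3 g3 g1 g2 f3 f1 f2] P g less by linarith
  next
    case 6 then show False using key[of z3 y3 x3 g3 g2 g1 f3 f2 f1] P g less by linarith
  qed
qed

text \<open>The outer triangle is cut out by the lower bounds \<open>- \<eta>\<^sub>i\<close> on the barycentric coordinates, the
  inner one by the lower bound \<open>2 \<sigma>\<close>; both are homothetic to the triangle of the \<open>V\<^sub>i\<close>, with the
  ratios \<open>1 + \<eta>\<^sub>1 + \<eta>\<^sub>2 + \<eta>\<^sub>3\<close> and \<open>1 - 6 \<sigma>\<close>.\<close>

lemma bm_ratios_barycentric:
  fixes V1 V2 V3 :: "real ^ 2"
  assumes K: "convex K" "closed K" and abc: "\<not> collinear {a, b, c :: real ^ 2}"
    and V: "wedge (V2 - V1) (V3 - V1) \<noteq> 0" and \<sigma>: "0 \<le> \<sigma>" "\<sigma> < 1 / 6" and \<eta>: "0 \<le> \<eta>1" "0 \<le> \<eta>2" "0 \<le> \<eta>3"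
    and P: "x1 + y1 + z1 = 1" "x1 *\<^sub>R V1 + y1 *\<^sub>R V2 + z1 *\<^sub>R V3 \<in> K" "x1 \<ge> 1 - \<sigma>" "y1 \<ge> - \<sigma>" "z1 \<ge> - \<sigma>"
      "x2 + y2 + z2 = 1" "x2 *\<^sub>R V1 + y2 *\<^sub>R V2 + z2 *\<^sub>R V3 \<in> K" "x2 \<ge> - \<sigma>" "y2 \<ge> 1 - \<sigma>" "z2 \<ge> - \<sigma>"
      "x3 + y3 + z3 = 1" "x3 *\<^sub>R V1 + y3 *\<^sub>R V2 + z3 *\<^sub>R V3 \<in> K" "x3 \<ge> - \<sigma>" "y3 \<ge> - \<sigma>" "z3 \<ge> 1 - \<sigma>"
    and outer: "\<And>x. x \<in> K \<Longrightarrow> \<exists>b1 b2 b3. b1 + b2 + b3 = 1 \<and> b1 \<ge> - \<eta>1 \<and> b2 \<ge> - \<eta>2 \<and> b3 \<ge> - \<eta>3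
        \<and> x = b1 *\<^sub>R V1 + b2 *\<^sub>R V2 + b3 *\<^sub>R V3"
  shows "(1 + \<eta>1 + \<eta>2 + \<eta>3) / (1 - 6 * \<sigma>) \<in> bm_ratios K (convex hull {a, b, c})"
proof -
  define E where "E = 1 + \<eta>1 + \<eta>2 + \<eta>3"
  define \<rho> where "\<rho> = (1 - 6 * \<sigma>) / E"
  have E: "E > 0" and \<rho>: "\<rho> > 0" and \<rho>E: "\<rho> * E = 1 - 6 * \<sigma>" using \<eta> \<sigma> by (auto simp: E_def \<rho>_def)
  define p where "p = E *\<^sub>R V1 - (\<eta>1 *\<^sub>R V1 + \<eta>2 *\<^sub>R V2 + \<eta>3 *\<^sub>R V3)"
  define q where "q = E *\<^sub>R V2 - (\<eta>1 *\<^sub>R V1 + \<eta>2 *\<^sub>R V2 + \<eta>3 *\<^sub>R V3)"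
  define r where "r = E *\<^sub>R V3 - (\<eta>1 *\<^sub>R V1 + \<eta>2 *\<^sub>R V2 + \<eta>3 *\<^sub>R V3)"
  define s where "s = (2 * \<sigma>) *\<^sub>R (V1 + V2 + V3) + \<rho> *\<^sub>R (\<eta>1 *\<^sub>R V1 + \<eta>2 *\<^sub>R V2 + \<eta>3 *\<^sub>R V3)"
  have "q - p = E *\<^sub>R (V2 - V1)" "r - p = E *\<^sub>R (V3 - V1)" by (simp_all add: p_def q_def r_def algebra_simps)
  then have pqr: "wedge (q - p) (r - p) \<noteq> 0" using E V by (simp add: wedge_algebra(5,6))
  have s: "s + \<rho> *\<^sub>R p = (1 - 4 * \<sigma>) *\<^sub>R V1 + (2 * \<sigma>) *\<^sub>R V2 + (2 * \<sigma>) *\<^sub>R V3"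
    "s + \<rho> *\<^sub>R q = (2 * \<sigma>) *\<^sub>R V1 + (1 - 4 * \<sigma>) *\<^sub>R V2 + (2 * \<sigma>) *\<^sub>R V3"
    "s + \<rho> *\<^sub>R r = (2 * \<sigma>) *\<^sub>R V1 + (2 * \<sigma>) *\<^sub>R V2 + (1 - 4 * \<sigma>) *\<^sub>R V3"
    by (simp_all add: s_def p_def q_def r_def scaleR_diff_right \<rho>E) (simp_all add: vec2_eq_iff algebra_simps)
  note inside = perturbed_triangle_contains[OF K \<sigma>(1) P]
  have "1 / \<rho> \<in> bm_ratios K (convex hull {a, b, c})"
  proof (rule bm_ratios_sandwiched[OF K(1) abc pqr _ \<rho>])
    show "K \<subseteq> convex hull {p, q, r}"
    proof
      fix x assume "x \<in> K"
      then obtain b1 b2 b3 where b: "b1 + b2 + b3 = 1" "b1 \<ge> - \<eta>1" "b2 \<ge> - \<eta>2" "b3 \<ge> - \<eta>3"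
        "x = b1 *\<^sub>R V1 + b2 *\<^sub>R V2 + b3 *\<^sub>R V3" using outer by blast
      let ?w = "\<lambda>b \<eta>. (b + \<eta>) / E"
      have sum: "?w b1 \<eta>1 + ?w b2 \<eta>2 + ?w b3 \<eta>3 = 1"
        using b(1) E by (simp add: add_divide_distrib[symmetric]) (simp add: E_def)
      have "?w b1 \<eta>1 *\<^sub>R p + ?w b2 \<eta>2 *\<^sub>R q + ?w b3 \<eta>3 *\<^sub>R r
          = (?w b1 \<eta>1 * E) *\<^sub>R V1 + (?w b2 \<eta>2 * E) *\<^sub>R V2 + (?w b3 \<eta>3 * E) *\<^sub>R V3
            - (?w b1 \<eta>1 + ?w b2 \<eta>2 + ?w b3 \<eta>3) *\<^sub>R (\<eta>1 *\<^sub>R V1 + \<eta>2 *\<^sub>R V2 + \<eta>3 *\<^sub>R V3)"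
        unfolding p_def q_def r_def scaleR_diff_right scaleR_add_left scaleR_scaleR by simp
      also have "\<dots> = x"
        unfolding sum nonzero_eq_divide_eq[OF E[THEN less_imp_neq, symmetric], THEN iffD1, OF refl] b(5)
        by (simp add: algebra_simps)
      finally have "x = ?w b1 \<eta>1 *\<^sub>R p + ?w b2 \<eta>2 *\<^sub>R q + ?w b3 \<eta>3 *\<^sub>R r" by simp
      moreover have "0 \<le> ?w b1 \<eta>1" "0 \<le> ?w b2 \<eta>2" "0 \<le> ?w b3 \<eta>3" using b E by auto
      ultimately show "x \<in> convex hull {p, q, r}" unfolding convex_hull_3 using sum by blast
    qed
    show "s + \<rho> *\<^sub>R p \<in> K" "s + \<rho> *\<^sub>R q \<in> K" "s + \<rho> *\<^sub>R r \<in> K"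
      unfolding s by (rule inside; use \<sigma> in simp)+
  qed
  moreover have "1 / \<rho> = (1 + \<eta>1 + \<eta>2 + \<eta>3) / (1 - 6 * \<sigma>)" by (simp add: \<rho>_def E_def)
  ultimately show ?thesis by simp
qed

section \<open>Bodies framed by the hexagon: the area\<close>

text \<open>The vertex with index \<^term>\<open>i\<close> joins the sides with indices \<^term>\<open>i\<close> and
  \<^term>\<open>Suc i\<close>.  Its two edges point in the directions of the vertices two places before and after it.\<close>

fun hex_corner :: "nat \<Rightarrow> real ^ 2" where
  "hex_corner 0 = vector [0, 1]"
| "hex_corner (Suc 0) = vector [-1, 1]"
| "hex_corner (Suc (Suc i)) = hex_corner (Suc i) - hex_corner i"

lemma hex_normal_periodic: "hex_normal (i + 6) = hex_normal i" "hex_normal (i + 3) = - hex_normal i"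
  by (simp_all add: eval_nat_numeral)

lemma corner_coordinates:
  assumes "i < 6"
  shows "z = hex_corner i + (1 - hex_normal i \<bullet> z) *\<^sub>R hex_corner (i + 2) + (1 - hex_normal (Suc i) \<bullet> z) *\<^sub>R hex_corner (i + 4)"
  using assms by (auto simp: eval_nat_numeral less_Suc_eq vec2_eq_iff inner_vec2 algebra_simps)

lemma wedge_corner_edges: "i < 6 \<Longrightarrow> wedge (hex_corner (i + 2)) (hex_corner (i + 4)) = 1"
  by (auto simp: eval_nat_numeral less_Suc_eq wedge_def)

lemma wedge_swap: "wedge u v = - wedge v u"
  by (simp add: wedge_def)

lemma wedge_sheared:
  "wedge (a *\<^sub>R u) (b *\<^sub>R u + c *\<^sub>R v) = a * c * wedge u v"
  "wedge (a *\<^sub>R v) (b *\<^sub>R u + c *\<^sub>R v) = a * b * wedge v u"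
  by (simp_all add: wedge_algebra)

lemma functional_in_sector:
  "\<exists>i<6. \<exists>\<alpha>\<ge>0. \<exists>\<beta>\<ge>0. f = \<alpha> *\<^sub>R hex_normal i + \<beta> *\<^sub>R hex_normal (Suc i)"
proof -
  have ex: ?thesis if "i < 6" "\<alpha> \<ge> 0" "\<beta> \<ge> 0" "f = \<alpha> *\<^sub>R hex_normal i + \<beta> *\<^sub>R hex_normal (Suc i)" for i \<alpha> \<beta>
    using that by blast
  consider "f$1 \<ge> 0" "f$2 \<ge> f$1" | "f$1 \<le> 0" "f$2 \<ge> 0" | "f$2 \<le> 0" "f$1 \<le> f$2"
    | "f$1 \<le> 0" "f$2 \<le> f$1" | "f$1 \<ge> 0" "f$2 \<le> 0" | "f$2 \<ge> 0" "f$2 \<le> f$1" by linarith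
  then show ?thesis
  proof cases
    case 1 then show ?thesis by (intro ex[of 0 "f$1" "f$2 - f$1"]) (auto simp: vec2_eq_iff)
  next
    case 2 then show ?thesis by (intro ex[of "Suc 0" "f$2" "- f$1"]) (auto simp: vec2_eq_iff)
  next
    case 3 then show ?thesis by (intro ex[of "Suc (Suc 0)" "f$2 - f$1" "- f$2"]) (auto simp: vec2_eq_iff)
  next
    case 4 then show ?thesis by (intro ex[of "Suc (Suc (Suc 0))" "- f$1" "f$1 - f$2"]) (auto simp: vec2_eq_iff)
  next
    case 5 then show ?thesis
      by (intro ex[of "Suc (Suc (Suc (Suc 0)))" "- f$2" "f$1"]) (auto simp: vec2_eq_iff)
  next
    case 6 then show ?thesis
      by (intro ex[of "Suc (Suc (Suc (Suc (Suc 0))))" "f$1 - f$2" "f$2"]) (auto simp: vec2_eq_iff)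
  qed
qed

definition hex_framed :: "(real ^ 2) set \<Rightarrow> bool" where
  "hex_framed K \<longleftrightarrow> convex_body K \<and> (\<forall>i. (\<forall>k\<in>K. hex_normal i \<bullet> k \<le> 1) \<and> (\<exists>k\<in>K. hex_normal i \<bullet> k = 1))"

text \<open>Measured by \<^term>\<open>hex_normal i + hex_normal (Suc i)\<close>, which is 2 at the vertex with index
  \<^term>\<open>i\<close>, this is how far the body stays away from that vertex.  The six depths determine both area bounds below;
  for the triangle on every other vertex they alternate between 0 and 1.\<close>

definition depth :: "(real ^ 2) set \<Rightarrow> nat \<Rightarrow> real" where
  "depth K i = 2 - (SUP k\<in>K. (hex_normal i + hex_normal (Suc i)) \<bullet> k)"

lemma depth_attained:
  assumes "hex_framed K"
  shows "\<exists>k\<in>K. (hex_normal i + hex_normal (Suc i)) \<bullet> k = 2 - depth K i"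
    and "\<And>k. k \<in> K \<Longrightarrow> (hex_normal i + hex_normal (Suc i)) \<bullet> k \<le> 2 - depth K i"
proof -
  let ?g = "hex_normal i + hex_normal (Suc i)"
  have K: "compact K" "K \<noteq> {}" using assms by (auto simp: hex_framed_def convex_body_def)
  moreover have "continuous_on K (\<lambda>k. ?g \<bullet> k)" by (intro continuous_intros)
  ultimately obtain k where k: "k \<in> K" "\<And>k'. k' \<in> K \<Longrightarrow> ?g \<bullet> k' \<le> ?g \<bullet> k"
    using continuous_attains_sup[of K "\<lambda>k. ?g \<bullet> k"] by blast
  then have "(SUP k\<in>K. ?g \<bullet> k) = ?g \<bullet> k"
    by (intro cSup_eq_maximum) auto
  then show "\<exists>k\<in>K. ?g \<bullet> k = 2 - depth K i" "\<And>k. k \<in> K \<Longrightarrow> ?g \<bullet> k \<le> 2 - depth K i"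
    using k by (auto simp: depth_def)
qed

lemma depth_periodic: "depth K (i + 6) = depth K i"
  using hex_normal_periodic(1)[of i] hex_normal_periodic(1)[of "Suc i"] by (simp add: depth_def)

lemma depth_nonneg:
  assumes "hex_framed K" shows "0 \<le> depth K i"
proof -
  obtain k where "k \<in> K" "(hex_normal i + hex_normal (Suc i)) \<bullet> k = 2 - depth K i"
    using depth_attained(1)[OF assms] by blast
  moreover have "hex_normal i \<bullet> k \<le> 1" "hex_normal (Suc i) \<bullet> k \<le> 1"
    using assms \<open>k \<in> K\<close> by (auto simp: hex_framed_def)
  ultimately show ?thesis by (simp add: inner_add_left)
qed

text \<open>A point on a side of the hexagon divides it into two parts of total length 1, and the depth at either end of
  the side is at most the length of the adjacent part.\<close>

lemma touching_point:
  assumes "hex_framed K"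
  obtains t where "t \<in> K" "hex_normal (Suc i) \<bullet> t = 1"
    "depth K i \<le> 1 - hex_normal i \<bullet> t" "depth K (Suc i) \<le> 1 - hex_normal (Suc (Suc i)) \<bullet> t"
    "(1 - hex_normal i \<bullet> t) + (1 - hex_normal (Suc (Suc i)) \<bullet> t) = 1"
proof -
  obtain t where t: "t \<in> K" "hex_normal (Suc i) \<bullet> t = 1" using assms by (auto simp: hex_framed_def)
  have "hex_normal (Suc (Suc i)) \<bullet> t = hex_normal (Suc i) \<bullet> t - hex_normal i \<bullet> t" by (simp add: inner_diff_left)
  then show thesis
    using depth_attained(2)[OF assms t(1), of i] depth_attained(2)[OF assms t(1), of "Suc i"] t
    unfolding inner_add_left by (intro that[of t]) linarith+
qed

lemma depth_adjacent_le:
  assumes "hex_framed K" shows "depth K i + depth K (Suc i) \<le> 1"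
  by (rule touching_point[OF assms, of i]) linarith

text \<open>In the coordinates of the two edges at a vertex, \<open>(a, 0)\<close> and \<open>(0, b)\<close> are points of the body on the
  edges and \<open>(p\<^sub>0, q\<^sub>0)\<close> is a further point of the body.  A point that is separated from these three by a functional
  with non-negative coefficients lies in one of the triangles which the segment from the origin to
  \<open>(p\<^sub>0, q\<^sub>0)\<close> makes with the edges.\<close>

lemma corner_dissection:
  fixes p q :: real
  assumes nonneg: "0 \<le> p" "0 \<le> q" "0 \<le> a" "0 \<le> b" "0 \<le> p0" "0 \<le> q0" "0 \<le> \<alpha>" "0 \<le> \<beta>"
    and less: "\<alpha> * p + \<beta> * q < \<alpha> * a" "\<alpha> * p + \<beta> * q < \<beta> * b" "\<alpha> * p + \<beta> * q < \<alpha> * p0 + \<beta> * q0"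
  shows "(\<exists>s\<ge>0. \<exists>t\<ge>0. s + t \<le> 1 \<and> p = s * a + t * p0 \<and> q = t * q0) \<or>
         (\<exists>s\<ge>0. \<exists>t\<ge>0. s + t \<le> 1 \<and> p = t * p0 \<and> q = s * b + t * q0)"
proof -
  have half: "\<exists>s\<ge>0. \<exists>t\<ge>0. s + t \<le> 1 \<and> p = s * a + t * p0 \<and> q = t * q0"
    if "0 \<le> p" "0 \<le> q" "0 \<le> a" "0 \<le> p0" "0 \<le> q0" "0 \<le> \<alpha>" "0 \<le> \<beta>" "q * p0 \<le> p * q0"
      "\<alpha> * p + \<beta> * q < \<alpha> * a" "\<alpha> * p + \<beta> * q < \<alpha> * p0 + \<beta> * q0"
    for p q a p0 q0 \<alpha> \<beta> :: real
  proof -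
    define v where "v = \<alpha> * p + \<beta> * q"
    have v: "0 \<le> v" using that by (simp add: v_def)
    then have "0 < \<alpha> * a" using that(9) unfolding v_def by linarith
    then have a: "0 < a" "0 < \<alpha>" using that by (auto simp: zero_less_mult_iff)
    show ?thesis
    proof (cases "q0 = 0")
      case True
      then have "p0 \<noteq> 0" using that(10) v unfolding v_def by auto
      then have "q = 0" using that True by (simp add: mult_le_0_iff)
      moreover have "p < a" using that a \<open>q = 0\<close> by simp
      ultimately show ?thesis using a that True
        by (intro exI[of _ "p / a"] conjI exI[of _ 0]) auto
    next
      case False
      define t where "t = q / q0"
      define s where "s = (p - t * p0) / a"
      have q: "q = t * q0" and p: "p = s * a + t * p0" using False a by (auto simp: t_def s_def)
      have t: "0 \<le> t" using that False by (simp add: t_def)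
      have "t * p0 \<le> p" using that False by (simp add: t_def field_simps)
      then have s: "0 \<le> s" using a by (simp add: s_def)
      have "v = s * (\<alpha> * a) + t * (\<alpha> * p0 + \<beta> * q0)" unfolding v_def p q by (simp add: algebra_simps)
      moreover have "s * v \<le> s * (\<alpha> * a)" "t * v \<le> t * (\<alpha> * p0 + \<beta> * q0)"
        using that s t by (auto intro!: mult_left_mono simp: v_def)
      ultimately have *: "(s + t) * v \<le> v" by (simp add: algebra_simps)
      have "s + t \<le> 1"
      proof (rule ccontr)
        assume "\<not> s + t \<le> 1"
        then have st: "s + t > 1" by simp
        have "v = 0"
        proof (rule ccontr)
          assume "v \<noteq> 0"
          then have "v * 1 < v * (s + t)" using v st by (intro mult_strict_left_mono) auto
          then show False using * by (simp add: mult.commute)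
        qed
        then have "s * (\<alpha> * a) + t * (\<alpha> * p0 + \<beta> * q0) = 0" "0 < \<alpha> * a" "0 < \<alpha> * p0 + \<beta> * q0"
          using \<open>v = s * _ + _\<close> that v_def by auto
        then have "s = 0 \<and> t = 0"
          using s t by (metis add_nonneg_eq_0_iff less_le mult_eq_0_iff mult_nonneg_nonneg)
        then show False using st by simp
      qed
      then show ?thesis using s t p q by blast
    qed
  qed
  show ?thesis
  proof (cases "q * p0 \<le> p * q0")
    case True
    then show ?thesis using half[of p q a p0 q0 \<alpha> \<beta>] assms by blast
  next
    case False
    then have "\<exists>s\<ge>0. \<exists>t\<ge>0. s + t \<le> 1 \<and> q = s * b + t * q0 \<and> p = t * p0"
      using assms by (intro half[of q p b q0 p0 \<beta> \<alpha>]) (auto simp: add.commute)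
    then show ?thesis by blast
  qed
qed

lemma in_triangle:
  assumes "0 \<le> s" "0 \<le> t" "s + t \<le> (1 :: real)"
  shows "c + s *\<^sub>R u + t *\<^sub>R v \<in> convex hull {c, c + u, c + v}"
proof -
  have "c + s *\<^sub>R u + t *\<^sub>R v = (1 - s - t) *\<^sub>R c + s *\<^sub>R (c + u) + t *\<^sub>R (c + v)"
    by (simp add: algebra_simps)
  moreover have "0 \<le> 1 - s - t" "(1 - s - t) + s + t = 1" using assms by auto
  ultimately show ?thesis unfolding convex_hull_3 using assms by blast
qed

text \<open>The points cut off from the body by a supporting line whose normal lies between the normals of two
  adjacent sides.\<close>

definition corner_region :: "(real ^ 2) set \<Rightarrow> nat \<Rightarrow> (real ^ 2) set" where
  "corner_region K i = {z. hex_normal i \<bullet> z \<le> 1 \<and> hex_normal (Suc i) \<bullet> z \<le> 1 \<and>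
     (\<exists>\<alpha>\<ge>0. \<exists>\<beta>\<ge>0. \<forall>k\<in>K. (\<alpha> *\<^sub>R hex_normal i + \<beta> *\<^sub>R hex_normal (Suc i)) \<bullet> k < (\<alpha> *\<^sub>R hex_normal i + \<beta> *\<^sub>R hex_normal (Suc i)) \<bullet> z)}"

text \<open>With the touching points at distances \<open>\<alpha>\<close> and \<open>\<beta>\<close> from the vertex, and a point \<open>(p, q)\<close> of the body with
  \<open>p + q\<close> equal to the depth, the two covering triangles have total area \<open>(\<alpha> q + \<beta> p) / 2\<close>.  Bounding
  \<open>\<alpha>\<close> and \<open>\<beta>\<close> by 1 would already give the sharp inequality for the product; bounding them through the depths at the
  neighbouring vertices gives the extra term on which stability rests.\<close>

lemma corner_region_covered:
  assumes K: "hex_framed K" and i: "i < 6"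
  shows "\<exists>T. corner_region K i \<subseteq> T \<and> T \<in> lmeasurable \<and>
    measure lebesgue T \<le> depth K i * (1 - min (depth K (i + 5)) (depth K (i + 1))) / 2"
proof -
  let ?p = "\<lambda>z. 1 - hex_normal i \<bullet> z" and ?q = "\<lambda>z. 1 - hex_normal (Suc i) \<bullet> z"
  let ?c = "hex_corner i" and ?u = "hex_corner (i + 2)" and ?v = "hex_corner (i + 4)"
  have coords: "z = ?c + ?p z *\<^sub>R ?u + ?q z *\<^sub>R ?v" for z using corner_coordinates[OF i] .
  have bounds: "0 \<le> ?p k" "0 \<le> ?q k" if "k \<in> K" for k using K that by (auto simp: hex_framed_def)
  obtain k where k: "k \<in> K" "(hex_normal i + hex_normal (Suc i)) \<bullet> k = 2 - depth K i"
    using depth_attained(1)[OF K] by blast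
  obtain A where A: "A \<in> K" "?q A = 0" "?p A \<le> 1 - depth K (i + 1)"
    by (rule touching_point[OF K, of i]) (use that in auto)
  obtain B where B: "B \<in> K" "?p B = 0" "?q B \<le> 1 - depth K (i + 5)"
  proof (rule touching_point[OF K, of "i + 5"])
    fix t assume t: "t \<in> K" "hex_normal (Suc (i + 5)) \<bullet> t = 1" "depth K (i + 5) \<le> 1 - hex_normal (i + 5) \<bullet> t"
      "(1 - hex_normal (i + 5) \<bullet> t) + (1 - hex_normal (Suc (Suc (i + 5))) \<bullet> t) = 1"
    have "Suc (i + 5) = i + 6" "Suc (Suc (i + 5)) = Suc i + 6" by simp_all
    then have "hex_normal (Suc (i + 5)) = hex_normal i" "hex_normal (Suc (Suc (i + 5))) = hex_normal (Suc i)"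
      by (metis hex_normal_periodic(1))+
    then show thesis using t by (intro that[of t]) auto
  qed
  define T1 where "T1 = convex hull {?c, ?c + ?p A *\<^sub>R ?u, ?c + (?p k *\<^sub>R ?u + ?q k *\<^sub>R ?v)}"
  define T2 where "T2 = convex hull {?c, ?c + ?q B *\<^sub>R ?v, ?c + (?p k *\<^sub>R ?u + ?q k *\<^sub>R ?v)}"
  have T: "T1 \<in> lmeasurable" "T2 \<in> lmeasurable" by (simp_all add: T1_def T2_def lmeasurable_triangle)
  have uv: "wedge ?u ?v = 1" "wedge ?v ?u = -1"
    using wedge_corner_edges[OF i] wedge_swap[of ?v ?u] by simp_all
  have m1: "measure lebesgue T1 = ?p A * ?q k / 2"
    unfolding T1_def content_triangle_wedge wedge_sheared uv
    using bounds[OF A(1)] bounds[OF k(1)] by (simp add: abs_mult)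
  have m2: "measure lebesgue T2 = ?q B * ?p k / 2"
    unfolding T2_def content_triangle_wedge wedge_sheared uv
    using bounds[OF B(1)] bounds[OF k(1)] by (simp add: abs_mult)
  have "corner_region K i \<subseteq> T1 \<union> T2"
  proof
    fix z assume "z \<in> corner_region K i"
    then obtain \<alpha> \<beta> where z: "0 \<le> ?p z" "0 \<le> ?q z" and ab: "\<alpha> \<ge> 0" "\<beta> \<ge> 0"
      and sep: "\<And>k. k \<in> K \<Longrightarrow> (\<alpha> *\<^sub>R hex_normal i + \<beta> *\<^sub>R hex_normal (Suc i)) \<bullet> k < (\<alpha> *\<^sub>R hex_normal i + \<beta> *\<^sub>R hex_normal (Suc i)) \<bullet> z"
      unfolding corner_region_def by auto
    have less: "\<alpha> * ?p z + \<beta> * ?q z < \<alpha> * ?p k + \<beta> * ?q k" if "k \<in> K" for k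
      using sep[OF that] by (simp add: inner_add_left algebra_simps)
    have "(\<exists>s\<ge>0. \<exists>t\<ge>0. s + t \<le> 1 \<and> ?p z = s * ?p A + t * ?p k \<and> ?q z = t * ?q k) \<or>
         (\<exists>s\<ge>0. \<exists>t\<ge>0. s + t \<le> 1 \<and> ?p z = t * ?p k \<and> ?q z = s * ?q B + t * ?q k)"
      using corner_dissection[OF z bounds(1)[OF A(1)] bounds(2)[OF B(1)] bounds[OF k(1)] ab]
        less[OF A(1)] less[OF B(1)] less[OF k(1)] A(2) B(2) by simp
    then show "z \<in> T1 \<union> T2"
    proof (elim disjE exE conjE)
      fix s t assume st: "0 \<le> s" "0 \<le> t" "s + t \<le> 1" "?p z = s * ?p A + t * ?p k" "?q z = t * ?q k"
      have "z = ?c + s *\<^sub>R (?p A *\<^sub>R ?u) + t *\<^sub>R (?p k *\<^sub>R ?u + ?q k *\<^sub>R ?v)"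
        by (subst coords[of z], unfold st(4,5)) (simp add: algebra_simps)
      then show ?thesis using in_triangle[OF st(1-3)] unfolding T1_def by (metis UnI1)
    next
      fix s t assume st: "0 \<le> s" "0 \<le> t" "s + t \<le> 1" "?p z = t * ?p k" "?q z = s * ?q B + t * ?q k"
      have "z = ?c + s *\<^sub>R (?q B *\<^sub>R ?v) + t *\<^sub>R (?p k *\<^sub>R ?u + ?q k *\<^sub>R ?v)"
        by (subst coords[of z], unfold st(4,5)) (simp add: algebra_simps)
      then show ?thesis using in_triangle[OF st(1-3)] unfolding T2_def by (metis UnI2)
    qed
  qed
  moreover have "measure lebesgue (T1 \<union> T2) \<le> depth K i * (1 - min (depth K (i + 5)) (depth K (i + 1))) / 2"
  proof -
    let ?\<mu> = "1 - min (depth K (i + 5)) (depth K (i + 1))"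
    have "measure lebesgue (T1 \<union> T2) \<le> measure lebesgue T1 + measure lebesgue T2"
      using T by (intro measure_Un_le) auto
    also have "\<dots> = (?p A * ?q k + ?q B * ?p k) / 2" using m1 m2 by simp
    also have "\<dots> \<le> (?\<mu> * ?q k + ?\<mu> * ?p k) / 2"
      using A(3) B(3) bounds[OF k(1)] by (intro divide_right_mono add_mono mult_right_mono) auto
    also have "?\<mu> * ?q k + ?\<mu> * ?p k = ?\<mu> * (?q k + ?p k)" by (simp add: algebra_simps)
    also have "?q k + ?p k = depth K i" using k(2) by (simp add: inner_add_left)
    finally show ?thesis by (simp add: mult.commute)
  qed
  ultimately show ?thesis using T by (intro exI[of _ "T1 \<union> T2"]) auto
qed

text \<open>The hexagon has area 3, and any point of it outside the body lies in one of the six corner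
  regions, because a separating functional lies between two adjacent normals.\<close>

lemma measure_framed_ge:
  assumes K: "hex_framed K"
  shows "3 - (\<Sum>i<6. depth K i * (1 - min (depth K (i + 5)) (depth K (i + 1)))) / 2 \<le> measure lebesgue K"
proof -
  define H where "H = {z. \<forall>i<6. hex_normal i \<bullet> z \<le> 1}"
  define X where "X i = depth K i * (1 - min (depth K (i + 5)) (depth K (i + 1))) / 2" for i
  have KH: "K \<subseteq> H" and cb: "convex K" "compact K" using K by (auto simp: H_def hex_framed_def convex_body_def)
  have "H = (\<Inter>i\<in>{..<6}. {z. hex_normal i \<bullet> z \<le> 1})" by (auto simp: H_def)
  then have convH: "convex H" and clH: "closed H"
    by (auto intro!: convex_INT closed_INT convex_halfspace_le closed_halfspace_le simp del: INT_iff)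
  have Hlist: "z \<in> H \<longleftrightarrow> \<bar>z$1\<bar> \<le> 1 \<and> \<bar>z$2\<bar> \<le> 1 \<and> \<bar>z$1 + z$2\<bar> \<le> 1" for z
    by (auto simp: H_def eval_nat_numeral All_less_Suc inner_vec2)
  have "H \<subseteq> cbox (vector [-1, -1]) (vector [1, 1])"
    by (auto simp: Hlist mem_box_cart forall_2)
  then have "bounded H" using bounded_subset bounded_cbox by blast
  then have mH: "H \<in> lmeasurable" using convH by (simp add: measurable_convex)
  have "3 \<le> measure lebesgue H"
  proof -
    \<comment> \<open>Boundary points of the hexagon in the directions of its normals and of their bisectors.\<close>
    define r where "r i = [1/2, 1, 1, 1/2, 1, 1, 1/2 :: real] ! i" for i
    define \<rho> where "\<rho> i = [1/3, 1, 1/3, 1/3, 1, 1/3 :: real] ! i" for i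
    have "r i > 0 \<and> r i *\<^sub>R hex_normal i \<in> H" if "i \<le> 6" for i
      using that by (auto simp: eval_nat_numeral le_Suc_eq r_def Hlist)
    moreover have "\<rho> i > 0 \<and> \<rho> i *\<^sub>R (hex_normal i + hex_normal (Suc i)) \<in> H" if "i < 6" for i
      using that by (auto simp: eval_nat_numeral less_Suc_eq \<rho>_def Hlist)
    moreover have "0 \<in> H" by (simp add: H_def)
    ultimately have "(\<Sum>i<6. \<rho> i * (r i + r (Suc i))) / 2 \<le> measure lebesgue H"
      using convH mH by (intro hexagonal_fan_area) auto
    moreover have "(\<Sum>i<6. \<rho> i * (r i + r (Suc i))) / 2 = 3"
      by (simp add: eval_nat_numeral r_def \<rho>_def)
    ultimately show ?thesis by simp
  qed
  obtain T where T: "\<And>i. i < 6 \<Longrightarrow> corner_region K i \<subseteq> T i" "\<And>i. i < 6 \<Longrightarrow> T i \<in> lmeasurable"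
    "\<And>i. i < 6 \<Longrightarrow> measure lebesgue (T i) \<le> X i"
    using corner_region_covered[OF K] unfolding X_def by metis
  have "H \<subseteq> K \<union> (\<Union>i<6. T i)"
  proof
    fix z assume z: "z \<in> H"
    show "z \<in> K \<union> (\<Union>i<6. T i)"
    proof (cases "z \<in> K")
      case False
      then obtain f d where f: "f \<bullet> z < d" "\<And>k. k \<in> K \<Longrightarrow> d < f \<bullet> k"
        using separating_hyperplane_closed_point[of K z] cb compact_imp_closed by blast
      obtain i \<alpha> \<beta> where i: "i < 6" "\<alpha> \<ge> 0" "\<beta> \<ge> 0" "- f = \<alpha> *\<^sub>R hex_normal i + \<beta> *\<^sub>R hex_normal (Suc i)"
        using functional_in_sector[of "- f"] by blast
      have "(- f) \<bullet> k < (- f) \<bullet> z" if "k \<in> K" for k using f(1) f(2)[OF that] by simp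
      moreover have "hex_normal i \<bullet> z \<le> 1" "hex_normal (Suc i) \<bullet> z \<le> 1"
      proof -
        have all: "\<forall>j<6. hex_normal j \<bullet> z \<le> 1" using z by (simp add: H_def)
        then show "hex_normal i \<bullet> z \<le> 1" using i(1) by blast
        show "hex_normal (Suc i) \<bullet> z \<le> 1"
        proof (cases "Suc i < 6")
          case False
          then have "Suc i = 0 + 6" using i(1) by simp
          then have "hex_normal (Suc i) = hex_normal 0" using hex_normal_periodic(1)[of 0] by metis
          then show ?thesis using all by (metis zero_less_numeral)
        qed (use all in blast)
      qed
      ultimately have "z \<in> corner_region K i"
        unfolding corner_region_def mem_Collect_eq i(4)
        by (intro conjI exI[of _ \<alpha>] exI[of _ \<beta>] ballI i(2,3))
      then show ?thesis using T(1)[OF i(1)] i(1) by blast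
    qed simp
  qed
  then have "measure lebesgue H \<le> measure lebesgue (K \<union> (\<Union>i<6. T i))"
    using mH cb T(2) by (intro measure_mono_fmeasurable fmeasurable.Un fmeasurable.finite_UN) (auto simp: lmeasurable_compact)
  also have "\<dots> \<le> measure lebesgue K + measure lebesgue (\<Union>i<6. T i)"
    using cb T(2) by (intro measure_Un_le sets.finite_UN) (auto simp: lmeasurable_compact fmeasurableD)
  also have "measure lebesgue (\<Union>i<6. T i) \<le> (\<Sum>i<6. measure lebesgue (T i))"
    using T(2) by (intro measure_UNION_le) auto
  also have "\<dots> \<le> (\<Sum>i<6. X i)" using T(3) by (intro sum_mono) auto
  finally have "3 \<le> measure lebesgue K + (\<Sum>i<6. X i)" using \<open>3 \<le> measure lebesgue H\<close> by simp
  then show ?thesis by (simp add: X_def sum_divide_distrib)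
qed

section \<open>Bodies framed by the hexagon: the area of the polar\<close>

abbreviation half_difference_polar :: "'a::euclidean_space set \<Rightarrow> 'a set" where
  "half_difference_polar K \<equiv> {\<xi>. \<forall>k\<in>K. \<forall>k'\<in>K. \<xi> \<bullet> k - \<xi> \<bullet> k' \<le> 2}"

lemma polar_body_difference:
  "polar_body ((*\<^sub>R) (1/2) ` difference_body K) = half_difference_polar K"
  by (fastforce simp: polar_body_def difference_body_def inner_diff_right)

lemma polar_difference_measurable:
  fixes K :: "'a::euclidean_space set"
  assumes "convex_body K"
  shows "half_difference_polar K \<in> lmeasurable" (is "?S \<in> _")
    and "convex (half_difference_polar K)"
proof -
  have "?S = (\<Inter>k\<in>K. \<Inter>k'\<in>K. {\<xi>. (k - k') \<bullet> \<xi> \<le> 2})" by (auto simp: inner_commute inner_diff_right)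
  then show conv: "convex ?S"
    by (simp only:) (intro convex_INT convex_halfspace_le)
  obtain p r where r: "r > 0" "cball p r \<subseteq> K"
    using assms mem_interior_cball unfolding convex_body_def by blast
  have "norm \<xi> \<le> 2 / r" if \<xi>: "\<xi> \<in> ?S" for \<xi>
  proof (cases "\<xi> = 0")
    case False
    define k where "k = p + (r / norm \<xi>) *\<^sub>R \<xi>"
    have "k \<in> K" "p \<in> K" using r False by (auto simp: k_def dist_norm)
    then have "\<xi> \<bullet> k - \<xi> \<bullet> p \<le> 2" using \<xi> by blast
    then have "r * norm \<xi> \<le> 2"
      using False by (simp add: k_def inner_add_right power2_norm_eq_inner[symmetric] power2_eq_square)
    then show ?thesis using r by (simp add: field_simps)
  qed (use r in simp)
  then have "bounded ?S" unfolding bounded_iff by blast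
  then show "?S \<in> lmeasurable" using conv by (rule measurable_convex[rotated])
qed

text \<open>The polar contains the six normals, and on the bisector of two adjacent normals it reaches as far as the depths at
  two opposite vertices determine.  The fan of these twelve points has the area
  \<open>\<Sum> 2 / (4 - x\<^sub>i - x\<^sub>i\<^sub>+\<^sub>3)\<close>, where \<open>x\<^sub>i\<close> are the depths, and the inequality of the arithmetic and the
  harmonic mean turns this into a function of the sum of all depths.\<close>

lemma measure_polar_framed_ge:
  assumes K: "hex_framed K"
  shows "36 / (12 - (\<Sum>i<6. depth K i))
    \<le> measure lebesgue (half_difference_polar K)" (is "_ \<le> measure lebesgue ?S")
proof -
  define y where "y i = 4 - (depth K i + depth K (i + 3))" for i
  have d: "depth K i \<le> 1" for i
    using depth_adjacent_le[OF K, of i] depth_nonneg[OF K, of "Suc i"] by linarith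
  have y: "y i > 0" for i using d[of i] d[of "i + 3"] by (simp add: y_def)
  have three: "i + 3 = Suc (Suc (Suc i))" for i :: nat by simp
  have opp: "hex_normal (Suc (Suc (Suc i))) = - hex_normal i" "hex_normal (Suc (Suc (Suc (Suc i)))) = - hex_normal (Suc i)" for i
    by simp_all
  have le1: "hex_normal i \<bullet> k \<le> 1" if "k \<in> K" for i k using K that by (auto simp: hex_framed_def)
  have r: "hex_normal i \<in> ?S" for i
  proof (intro CollectI ballI)
    fix k k' assume "k \<in> K" "k' \<in> K"
    then have "hex_normal i \<bullet> k \<le> 1" "(- hex_normal i) \<bullet> k' \<le> 1"
      using le1[of k i] le1[of k' "Suc (Suc (Suc i))"] unfolding opp by auto
    then show "hex_normal i \<bullet> k - hex_normal i \<bullet> k' \<le> 2" by simp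
  qed
  have \<rho>: "(2 / y i) *\<^sub>R (hex_normal i + hex_normal (Suc i)) \<in> ?S" for i
  proof (intro CollectI ballI)
    fix k k' assume kk: "k \<in> K" "k' \<in> K"
    have "(hex_normal i + hex_normal (Suc i)) \<bullet> k \<le> 2 - depth K i" using depth_attained(2)[OF K kk(1)] .
    moreover have "(- hex_normal i + - hex_normal (Suc i)) \<bullet> k' \<le> 2 - depth K (i + 3)"
      using depth_attained(2)[OF K kk(2), of "i + 3"] unfolding three opp .
    ultimately have "(hex_normal i + hex_normal (Suc i)) \<bullet> k - (hex_normal i + hex_normal (Suc i)) \<bullet> k' \<le> y i"
      by (simp add: y_def inner_add_left inner_diff_left)
    then have "(2 / y i) * ((hex_normal i + hex_normal (Suc i)) \<bullet> k - (hex_normal i + hex_normal (Suc i)) \<bullet> k') \<le> (2 / y i) * y i"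
      using y[of i] by (intro mult_left_mono) auto
    then show "((2 / y i) *\<^sub>R (hex_normal i + hex_normal (Suc i))) \<bullet> k - ((2 / y i) *\<^sub>R (hex_normal i + hex_normal (Suc i))) \<bullet> k' \<le> 2"
      using y[of i] by (simp add: right_diff_distrib)
  qed
  have cb: "convex_body K" using K by (simp add: hex_framed_def)
  have "(\<Sum>i<6. 2 / y i * (1 + 1)) / 2 \<le> measure lebesgue ?S"
    by (rule hexagonal_fan_area[where r = "\<lambda>_. 1"])
      (use polar_difference_measurable[OF cb] r \<rho> y in auto)
  also have "(\<Sum>i<6. 2 / y i * (1 + 1)) / 2 = (\<Sum>i<6. 2 / y i)" by (simp add: sum_divide_distrib)
  finally have S: "(\<Sum>i<6. 2 / y i) \<le> measure lebesgue ?S" .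
  define s where "s = (\<Sum>i<6. depth K i)"
  define m where "m = 4 - s / 3"
  have "s \<le> 3"
    using depth_adjacent_le[OF K, of 0] depth_adjacent_le[OF K, of 2] depth_adjacent_le[OF K, of 4]
    by (simp add: s_def eval_nat_numeral)
  then have m: "m > 0" by (simp add: m_def)
  have "(\<Sum>i<6. depth K (i + 3)) = s"
    using depth_periodic[of K 0] depth_periodic[of K 1] depth_periodic[of K 2]
    by (simp add: s_def eval_nat_numeral)
  then have sumy: "(\<Sum>i<6. y i) = 6 * m"
    by (simp add: y_def sum_subtractf sum.distrib s_def[symmetric] m_def)
  \<comment> \<open>The right-hand side is the tangent of \<open>2 / y\<close> at the mean \<open>m\<close> of the \<open>y i\<close>.\<close>
  have "2 / y i \<ge> 4 / m - 2 * y i / m\<^sup>2" for i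
  proof -
    have "0 \<le> 2 * (m - y i)\<^sup>2 / (y i * m\<^sup>2)" using y[of i] by simp
    also have "\<dots> = 2 / y i - (4 / m - 2 * y i / m\<^sup>2)"
      using y[of i] m by (simp add: field_simps power2_eq_square)
    finally show ?thesis by simp
  qed
  then have "(\<Sum>i<6. 4 / m - 2 * y i / m\<^sup>2) \<le> (\<Sum>i<6. 2 / y i)" by (intro sum_mono)
  also have "(\<Sum>i<6. 4 / m - 2 * y i / m\<^sup>2) = 24 / m - 2 * (\<Sum>i<6. y i) / m\<^sup>2"
    by (simp add: sum_subtractf sum_divide_distrib sum_distrib_left)
  also have "\<dots> = 12 / m" unfolding sumy using m by (simp add: power2_eq_square field_simps)
  also have "12 / m = 36 / (12 - s)" using m by (simp add: m_def field_simps)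
  finally show ?thesis using S by (simp add: s_def)
qed

section \<open>Stability for framed bodies\<close>

lemma nearest_to_corner:
  assumes "hex_framed K"
  obtains k where "k \<in> K" "(hex_normal i + hex_normal (Suc i)) \<bullet> k = 2 - depth K i" "hex_normal i \<bullet> k \<le> 1" "hex_normal (Suc i) \<bullet> k \<le> 1"
  using depth_attained(1)[OF assms, of i] assms unfolding hex_framed_def by blast

text \<open>The comparison triangle has every other vertex of the hexagon as its vertices.  Depths near 0 at these
  vertices provide points of the body close to them; depths near 1 at the remaining vertices confine the body to
  a slightly larger triangle.\<close>

lemma framed_bm_ratio:
  assumes K: "hex_framed K" and abc: "\<not> collinear {a, b, c :: real ^ 2}"
    and small: "depth K 0 + depth K 2 + depth K 4 < 1 / 2"
  shows "(1 + (3 - (depth K 1 + depth K 3 + depth K 5)) / 3) / (1 - 2 * (depth K 0 + depth K 2 + depth K 4))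
    \<in> bm_ratios K (convex hull {a, b, c})"
proof -
  define E where "E = depth K 0 + depth K 2 + depth K 4"
  have d0: "0 \<le> depth K i" for i by (rule depth_nonneg[OF K])
  have d1: "depth K i \<le> 1" for i using depth_adjacent_le[OF K, of i] d0[of "Suc i"] by linarith
  have E: "0 \<le> E" "depth K 0 \<le> E" "depth K 2 \<le> E" "depth K 4 \<le> E"
    using d0[of 0] d0[of 2] d0[of 4] by (auto simp: E_def)
  have cb: "convex K" "closed K" using K by (auto simp: hex_framed_def convex_body_def compact_imp_closed)
  define V1 V2 V3 :: "real ^ 2" where V: "V1 = vector [0, 1]" "V2 = vector [-1, 0]" "V3 = vector [1, -1]"
  define b1 b2 b3 where b: "b1 z = (1 + z$1 + 2 * z$2) / 3" "b2 z = (1 - 2 * z$1 - z$2) / 3"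
    "b3 z = (1 + z$1 - z$2) / 3" for z :: "real ^ 2"
  have sum: "b1 z + b2 z + b3 z = 1" and comb: "b1 z *\<^sub>R V1 + b2 z *\<^sub>R V2 + b3 z *\<^sub>R V3 = z" for z
    by (simp_all add: b V vec2_eq_iff field_simps)
  obtain k0 where k0: "k0 \<in> K" "(hex_normal 0 + hex_normal (Suc 0)) \<bullet> k0 = 2 - depth K 0"
    "hex_normal 0 \<bullet> k0 \<le> 1" "hex_normal (Suc 0) \<bullet> k0 \<le> 1" by (rule nearest_to_corner[OF K, of 0])
  obtain k2 where k2: "k2 \<in> K" "(hex_normal 2 + hex_normal (Suc 2)) \<bullet> k2 = 2 - depth K 2"
    "hex_normal 2 \<bullet> k2 \<le> 1" "hex_normal (Suc 2) \<bullet> k2 \<le> 1" by (rule nearest_to_corner[OF K, of 2])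
  obtain k4 where k4: "k4 \<in> K" "(hex_normal 4 + hex_normal (Suc 4)) \<bullet> k4 = 2 - depth K 4"
    "hex_normal 4 \<bullet> k4 \<le> 1" "hex_normal (Suc 4) \<bullet> k4 \<le> 1" by (rule nearest_to_corner[OF K, of 4])
  have x0: "b1 k0 \<ge> 1 - E / 3" "b2 k0 \<ge> - (E / 3)" "b3 k0 \<ge> - (E / 3)"
    using k0(2-4) E by (simp_all add: b inner_vec2)
  have x2: "b1 k2 \<ge> - (E / 3)" "b2 k2 \<ge> 1 - E / 3" "b3 k2 \<ge> - (E / 3)"
    using k2(2-4) E by (simp_all add: b inner_vec2 eval_nat_numeral)
  have x4: "b1 k4 \<ge> - (E / 3)" "b2 k4 \<ge> - (E / 3)" "b3 k4 \<ge> 1 - E / 3"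
    using k4(2-4) E by (simp_all add: b inner_vec2 eval_nat_numeral)
  have out: "depth K 3 - 1 \<le> 3 * b1 z" "depth K 5 - 1 \<le> 3 * b2 z" "depth K 1 - 1 \<le> 3 * b3 z" if "z \<in> K" for z
    using depth_attained(2)[OF K that, of 3] depth_attained(2)[OF K that, of 5] depth_attained(2)[OF K that, of 1]
    by (simp_all add: b inner_vec2 eval_nat_numeral)
  have "(1 + (1 - depth K 3) / 3 + (1 - depth K 5) / 3 + (1 - depth K 1) / 3) / (1 - 6 * (E / 3))
      \<in> bm_ratios K (convex hull {a, b, c})"
  proof (rule bm_ratios_barycentric[OF cb abc, of V2 V1 V3 "E / 3" _ _ _ "b1 k0" "b2 k0" "b3 k0"
        "b1 k2" "b2 k2" "b3 k2" "b1 k4" "b2 k4" "b3 k4"])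
    show "wedge (V2 - V1) (V3 - V1) \<noteq> 0" by (simp add: V wedge_def)
    show "\<exists>c1 c2 c3. c1 + c2 + c3 = 1 \<and> - ((1 - depth K 3) / 3) \<le> c1 \<and> - ((1 - depth K 5) / 3) \<le> c2
      \<and> - ((1 - depth K 1) / 3) \<le> c3 \<and> x = c1 *\<^sub>R V1 + c2 *\<^sub>R V2 + c3 *\<^sub>R V3" if "x \<in> K" for x
    proof -
      have "- ((1 - depth K 3) / 3) \<le> b1 x" "- ((1 - depth K 5) / 3) \<le> b2 x" "- ((1 - depth K 1) / 3) \<le> b3 x"
        using out[OF that] by (simp_all add: diff_divide_distrib)
      then show ?thesis using sum[of x] comb[of x] by metis
    qed
  qed (use x0 x2 x4 k0(1) k2(1) k4(1) sum comb d1 E small in \<open>simp_all add: E_def\<close>)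
  note ratio = this
  have num: "1 + (1 - depth K 3) / 3 + (1 - depth K 5) / 3 + (1 - depth K 1) / 3
    = 1 + (3 - (depth K 1 + depth K 3 + depth K 5)) / 3"
    by (simp add: diff_divide_distrib add_divide_distrib)
  have den: "1 - 6 * (E / 3) = 1 - 2 * E" by simp
  show ?thesis using ratio unfolding num den unfolding E_def .
qed

text \<open>Let \<open>d\<close> be 3 minus the sum of the depths and \<open>G\<close> the sum of the products of each depth with the smaller of
  its neighbours.  Clearing denominators in the product bound leaves \<open>3 G + 2 d \<le> \<epsilon> (9 + d)\<close>.  So
  \<open>d\<close> is of order \<open>\<epsilon>\<close>, whence the depths nearly alternate between two values of sum 1; as the odd ones, which
  have the larger sum, are then at least \<open>1 / 3\<close>, the bound on \<open>G\<close> makes the even ones of order \<open>\<epsilon>\<close>.\<close>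

lemma stability_arithmetic:
  fixes x0 x1 x2 x3 x4 x5 \<epsilon> :: real
  assumes nonneg: "0 \<le> x0" "0 \<le> x1" "0 \<le> x2" "0 \<le> x3" "0 \<le> x4" "0 \<le> x5"
    and adj: "x0 + x1 \<le> 1" "x1 + x2 \<le> 1" "x2 + x3 \<le> 1" "x3 + x4 \<le> 1" "x4 + x5 \<le> 1" "x5 + x0 \<le> 1"
    and \<epsilon>: "0 < \<epsilon>" "\<epsilon> < 1 / 29" and even_le_odd: "x0 + x2 + x4 \<le> x1 + x3 + x5"
    and product: "(3 - (x0 * (1 - min x5 x1) + x1 * (1 - min x0 x2) + x2 * (1 - min x1 x3)
        + x3 * (1 - min x2 x4) + x4 * (1 - min x3 x5) + x5 * (1 - min x4 x0)) / 2)
      * (36 / (12 - (x0 + x1 + x2 + x3 + x4 + x5))) \<le> (1 + \<epsilon>) * 6"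
  shows "x0 + x2 + x4 < 1 / 2"
    and "(1 + (3 - (x1 + x3 + x5)) / 3) / (1 - 2 * (x0 + x2 + x4)) \<le> 1 + 87 * \<epsilon>"
proof -
  define s where "s = x0 + x1 + x2 + x3 + x4 + x5"
  define d where "d = 3 - s"
  define G where "G = x0 * min x5 x1 + x1 * min x0 x2 + x2 * min x1 x3 + x3 * min x2 x4 + x4 * min x3 x5 + x5 * min x4 x0"
  have s: "12 - s > 0" and d: "0 \<le> d" "d \<le> 3" using adj nonneg by (auto simp: s_def d_def)
  have "(3 - (s - G) / 2) * (36 / (12 - s)) \<le> (1 + \<epsilon>) * 6"
    using product by (simp add: s_def G_def algebra_simps)
  then have "(3 - (s - G) / 2) * 36 \<le> (1 + \<epsilon>) * 6 * (12 - s)"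
    using s by (simp add: field_simps)
  moreover have "(3 - (s - G) / 2) * 36 = 108 - 18 * s + 18 * G" by (simp add: field_simps)
  ultimately have main: "3 * G + 2 * d \<le> \<epsilon> * (9 + d)" by (simp add: d_def algebra_simps)
  have odd: "x0 * min x5 x1 + x2 * min x1 x3 + x4 * min x3 x5 \<le> G" using nonneg by (simp add: G_def)
  have "0 \<le> x0 * min x5 x1 + x2 * min x1 x3 + x4 * min x3 x5" using nonneg by simp
  then have "0 \<le> G" using odd by linarith
  have ed: "\<epsilon> * d \<le> (1 / 29) * d" using \<epsilon> d by (intro mult_right_mono) auto
  have d5: "d \<le> 5 * \<epsilon>" using main ed \<open>0 \<le> G\<close> \<epsilon> by (simp add: algebra_simps)
  have "1 / 3 \<le> x1" "1 / 3 \<le> x3" "1 / 3 \<le> x5"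
    using d5 \<epsilon> even_le_odd adj by (simp_all add: d_def s_def)
  then have "x0 * (1 / 3) + x2 * (1 / 3) + x4 * (1 / 3) \<le> x0 * min x5 x1 + x2 * min x1 x3 + x4 * min x3 x5"
    using nonneg by (intro add_mono mult_left_mono) auto
  then have "x0 + x2 + x4 \<le> 3 * G" using odd by simp
  then have e9: "x0 + x2 + x4 \<le> 9 * \<epsilon>" using main ed d by (simp add: algebra_simps)
  then show "x0 + x2 + x4 < 1 / 2" using \<epsilon> by simp
  have pos: "0 < 1 - 18 * \<epsilon>" using \<epsilon> by simp
  have "(1 + (3 - (x1 + x3 + x5)) / 3) / (1 - 2 * (x0 + x2 + x4)) \<le> (1 + 5 * \<epsilon>) / (1 - 18 * \<epsilon>)"
    using e9 d5 \<epsilon> pos adj by (intro frac_le) (simp_all add: d_def s_def)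
  also have "\<dots> \<le> 1 + 87 * \<epsilon>"
  proof -
    have "\<epsilon> * \<epsilon> \<le> \<epsilon> * (1 / 29)" using \<epsilon> by (intro mult_left_mono) auto
    then have "1 + 5 * \<epsilon> \<le> (1 + 87 * \<epsilon>) * (1 - 18 * \<epsilon>)" using \<epsilon> by (simp add: algebra_simps)
    then show ?thesis using pos by (simp add: pos_divide_le_eq)
  qed
  finally show "(1 + (3 - (x1 + x3 + x5)) / 3) / (1 - 2 * (x0 + x2 + x4)) \<le> 1 + 87 * \<epsilon>" .
qed

lemma convex_body_linear_image:
  fixes f :: "'a::euclidean_space \<Rightarrow> 'a"
  assumes "convex_body K" "linear f" "inj f"
  shows "convex_body (f ` K)"
proof -
  have "continuous_on K f" using assms(2) by (simp add: linear_continuous_on linear_conv_bounded_linear)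
  then show ?thesis
    using assms unfolding convex_body_def
    by (simp add: compact_continuous_image convex_linear_image interior_injective_linear_image)
qed

text \<open>Reflection in the origin exchanges the even and the odd vertices of the hexagon.\<close>

lemma hex_framed_reflect:
  assumes K: "hex_framed K"
  shows "hex_framed (uminus ` K)" and "depth (uminus ` K) i = depth K (i + 3)"
proof -
  have opp: "hex_normal (i + 3) = - hex_normal i" for i by (rule hex_normal_periodic)
  have opp': "hex_normal (Suc (i + 3)) = - hex_normal (Suc i)" for i using opp[of "Suc i"] by simp
  have "convex_body (uminus ` K)"
    using K by (intro convex_body_linear_image) (auto simp: hex_framed_def linear_iff)
  moreover have "hex_normal i \<bullet> (- k) = hex_normal (i + 3) \<bullet> k" for i k unfolding opp by simp
  then have "(\<forall>k\<in>uminus ` K. hex_normal i \<bullet> k \<le> 1) \<and> (\<exists>k\<in>uminus ` K. hex_normal i \<bullet> k = 1)" for i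
    using K unfolding hex_framed_def by simp
  ultimately show "hex_framed (uminus ` K)" by (simp add: hex_framed_def)
  show "depth (uminus ` K) i = depth K (i + 3)"
    unfolding depth_def opp opp' by (simp add: image_image inner_add_left inner_diff_left)
qed

lemma affinity_uminus: "affinity (uminus :: 'a::euclidean_space \<Rightarrow> 'a)"
  unfolding affinity_def by (intro exI[of _ uminus] exI[of _ 0]) (auto simp: linear_iff intro: involuntory_imp_bij)

theorem framed_stability:
  assumes K: "hex_framed K" and abc: "\<not> collinear {a, b, c :: real ^ 2}" and \<epsilon>: "0 < \<epsilon>" "\<epsilon> < 1 / 29"
    and product: "measure lebesgue K * measure lebesgue (half_difference_polar K) \<le> (1 + \<epsilon>) * 6"
  shows "\<exists>r\<in>bm_ratios K (convex hull {a, b, c}). r \<le> 1 + 87 * \<epsilon>"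
proof -
  let ?x = "depth K"
  have x0: "0 \<le> ?x i" for i by (rule depth_nonneg[OF K])
  have p: "?x (i + 6) = ?x i" for i by (rule depth_periodic)
  have adj: "?x i + ?x (Suc i) \<le> 1" for i by (rule depth_adjacent_le[OF K])
  let ?A = "3 - (?x 0 * (1 - min (?x 5) (?x 1)) + ?x 1 * (1 - min (?x 0) (?x 2)) + ?x 2 * (1 - min (?x 1) (?x 3))
        + ?x 3 * (1 - min (?x 2) (?x 4)) + ?x 4 * (1 - min (?x 3) (?x 5)) + ?x 5 * (1 - min (?x 4) (?x 0))) / 2"
  let ?s = "?x 0 + ?x 1 + ?x 2 + ?x 3 + ?x 4 + ?x 5"
  have adjs: "?x 0 + ?x 1 \<le> 1" "?x 1 + ?x 2 \<le> 1" "?x 2 + ?x 3 \<le> 1" "?x 3 + ?x 4 \<le> 1" "?x 4 + ?x 5 \<le> 1"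
    "?x 5 + ?x 0 \<le> 1"
    using adj[of 0] adj[of 1] adj[of 2] adj[of 3] adj[of 4] adj[of 5] p[of 0] by (simp_all add: eval_nat_numeral)
  have A: "?A \<le> measure lebesgue K"
    using measure_framed_ge[OF K] p[of 0] p[of 1] p[of 2] p[of 3] p[of 4]
    by (simp add: eval_nat_numeral algebra_simps)
  have B: "36 / (12 - ?s) \<le> measure lebesgue (half_difference_polar K)"
    using measure_polar_framed_ge[OF K] by (simp add: eval_nat_numeral)
  have "0 \<le> 36 / (12 - ?s)" using adjs by simp
  then have AB: "?A * (36 / (12 - ?s)) \<le> (1 + \<epsilon>) * 6"
    using mult_mono[OF A B] product by simp
  show ?thesis
  proof (cases "?x 0 + ?x 2 + ?x 4 \<le> ?x 1 + ?x 3 + ?x 5")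
    case True
    note arith = stability_arithmetic[OF x0[of 0] x0[of 1] x0[of 2] x0[of 3] x0[of 4] x0[of 5] adjs \<epsilon> True AB]
    show ?thesis using framed_bm_ratio[OF K abc arith(1)] arith(2) by blast
  next
    case False
    let ?K = "uminus ` K"
    note K' = hex_framed_reflect(1)[OF K]
    have y: "depth ?K 0 = ?x 3" "depth ?K 1 = ?x 4" "depth ?K 2 = ?x 5" "depth ?K 3 = ?x 0"
      "depth ?K 4 = ?x 1" "depth ?K 5 = ?x 2"
      using hex_framed_reflect(2)[OF K] p[of 0] p[of 1] p[of 2] by (simp_all add: eval_nat_numeral)
    have False': "?x 3 + ?x 5 + ?x 1 \<le> ?x 4 + ?x 0 + ?x 2" using False by simp
    have AB': "(3 - (?x 3 * (1 - min (?x 2) (?x 4)) + ?x 4 * (1 - min (?x 3) (?x 5)) + ?x 5 * (1 - min (?x 4) (?x 0))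
        + ?x 0 * (1 - min (?x 5) (?x 1)) + ?x 1 * (1 - min (?x 0) (?x 2)) + ?x 2 * (1 - min (?x 1) (?x 3))) / 2)
      * (36 / (12 - (?x 3 + ?x 4 + ?x 5 + ?x 0 + ?x 1 + ?x 2))) \<le> (1 + \<epsilon>) * 6"
      using AB by (simp add: ac_simps)
    note arith = stability_arithmetic[OF x0[of 3] x0[of 4] x0[of 5] x0[of 0] x0[of 1] x0[of 2]
        adjs(4,5,6,1,2,3) \<epsilon> False' AB', folded y]
    show ?thesis
      using framed_bm_ratio[OF K' abc arith(1)] arith(2) bm_ratios_affinity_image[OF affinity_uminus, of K] by blast
  qed
qed

section \<open>Existence of a framing hexagon\<close>

definition support :: "'a::euclidean_space set \<Rightarrow> 'a \<Rightarrow> real" where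
  "support K \<xi> = (SUP k\<in>K. \<xi> \<bullet> k)"

context
  fixes K :: "'a::euclidean_space set"
  assumes body: "convex_body K"
begin

lemma support_attained: "\<exists>k\<in>K. \<xi> \<bullet> k = support K \<xi>"
  and support_upper: "k \<in> K \<Longrightarrow> \<xi> \<bullet> k \<le> support K \<xi>"
proof -
  have K: "compact K" "K \<noteq> {}" using body by (auto simp: convex_body_def)
  moreover have "continuous_on K (\<lambda>k. \<xi> \<bullet> k)" by (intro continuous_intros)
  ultimately obtain k0 where k0: "k0 \<in> K" "\<And>k. k \<in> K \<Longrightarrow> \<xi> \<bullet> k \<le> \<xi> \<bullet> k0"
    using continuous_attains_sup[of K "\<lambda>k. \<xi> \<bullet> k"] by blast
  then have "support K \<xi> = \<xi> \<bullet> k0" unfolding support_def by (intro cSup_eq_maximum) auto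
  then show "\<exists>k\<in>K. \<xi> \<bullet> k = support K \<xi>" "k \<in> K \<Longrightarrow> \<xi> \<bullet> k \<le> support K \<xi>"
    using k0 by auto
qed

lemma support_add_le: "support K (x + y) \<le> support K x + support K y"
  using support_attained[of "x + y"] support_upper by (metis add_mono inner_add_left)

lemma support_scale: "0 \<le> r \<Longrightarrow> support K (r *\<^sub>R x) = r * support K x"
proof -
  assume r: "0 \<le> r"
  obtain k where k: "k \<in> K" "x \<bullet> k = support K x" using support_attained by blast
  obtain k' where k': "k' \<in> K" "(r *\<^sub>R x) \<bullet> k' = support K (r *\<^sub>R x)" using support_attained by blast
  have "r * (x \<bullet> k') \<le> r * support K x" using support_upper[OF k'(1), of x] r by (rule mult_left_mono)
  moreover have "r * (x \<bullet> k) \<le> support K (r *\<^sub>R x)" using support_upper[OF k(1), of "r *\<^sub>R x"] by simp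
  ultimately show ?thesis using k k' by simp
qed

lemma continuous_support: "continuous_on UNIV (support K)"
proof (rule convex_on_continuous)
  show "convex_on UNIV (support K)"
  proof (rule convex_onI)
    fix t x y assume "0 < t" "t < (1::real)"
    then show "support K ((1 - t) *\<^sub>R x + t *\<^sub>R y) \<le> (1 - t) * support K x + t * support K y"
      using support_add_le[of "(1 - t) *\<^sub>R x" "t *\<^sub>R y"] by (simp add: support_scale)
  qed simp
qed simp

lemma width_pos: "x \<noteq> 0 \<Longrightarrow> support K x + support K (- x) > 0"
proof -
  assume x: "x \<noteq> 0"
  obtain p r where r: "r > 0" "cball p r \<subseteq> K"
    using body mem_interior_cball unfolding convex_body_def by blast
  have "p \<in> K" "p + (r / norm x) *\<^sub>R x \<in> K" using r x by (auto simp: dist_norm)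
  then have "x \<bullet> (p + (r / norm x) *\<^sub>R x) \<le> support K x" "(- x) \<bullet> p \<le> support K (- x)"
    by - (rule support_upper, assumption)+
  moreover have "x \<bullet> ((r / norm x) *\<^sub>R x) > 0" using r x by simp
  ultimately show ?thesis by (simp add: inner_add_right)
qed

end

definition half_width :: "'a::euclidean_space set \<Rightarrow> 'a \<Rightarrow> real" where
  "half_width K \<xi> = (support K \<xi> + support K (- \<xi>)) / 2"

text \<open>The value of the functional on the midline of the two support lines of the body perpendicular to it.\<close>

definition mid_value :: "'a::euclidean_space set \<Rightarrow> 'a \<Rightarrow> real" where
  "mid_value K \<xi> = (support K \<xi> - support K (- \<xi>)) / 2"

lemma plane_norm_half_width:
  assumes "convex_body K" shows "plane_norm (half_width K)"
proof
  fix x y :: "real ^ 2" and r :: real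
  show "half_width K (x + y) \<le> half_width K x + half_width K y"
    using support_add_le[OF assms, of x y] support_add_le[OF assms, of "- x" "- y"]
    by (simp add: half_width_def field_simps)
  show "half_width K (r *\<^sub>R x) = \<bar>r\<bar> * half_width K x"
  proof (cases "r \<ge> 0")
    case True
    then show ?thesis
      using support_scale[OF assms, of r x] support_scale[OF assms, of r "- x"]
      by (simp add: half_width_def algebra_simps)
  next
    case False
    then show ?thesis
      using support_scale[OF assms, of "- r" x] support_scale[OF assms, of "- r" "- x"]
      by (simp add: half_width_def algebra_simps)
  qed
  show "x \<noteq> 0 \<Longrightarrow> 0 < half_width K x" using width_pos[OF assms] by (simp add: half_width_def)
qed

text \<open>The normals are, up to sign, the first three of them.\<close>

lemma hex_normal_all:
  assumes "P (hex_normal 0)" "P (hex_normal 1)" "P (hex_normal 2)" "\<And>n. P n \<Longrightarrow> P (- n)"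
  shows "P (hex_normal i)"
proof (induction i rule: less_induct)
  case (less i)
  show ?case
  proof (cases "i < 3")
    case True
    then have "i = 0 \<or> i = 1 \<or> i = 2" by auto
    then show ?thesis using assms(1-3) by blast
  next
    case False
    then obtain j where j: "i = j + 3" by (metis add.commute le_Suc_ex not_less)
    then show ?thesis using less[of j] assms(4) hex_normal_periodic(2)[of j] by simp
  qed
qed

lemma measure_affine_image:
  fixes f :: "real ^ 2 \<Rightarrow> real ^ 2"
  assumes "S \<in> lmeasurable" "linear f"
  shows "measure lebesgue ((\<lambda>x. f x + c) ` S) = \<bar>wedge (f (axis 1 1)) (f (axis 2 1))\<bar> * measure lebesgue S"
proof -
  have "(\<lambda>x. f x + c) ` S = (+) c ` f ` S" by (auto simp: image_image add.commute)
  then have "measure lebesgue ((\<lambda>x. f x + c) ` S) = measure lebesgue (f ` S)"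
    by (simp add: measure_translation)
  also have "\<dots> = \<bar>det (matrix f)\<bar> * measure lebesgue S" using assms by (intro measure_linear_image) auto
  also have "det (matrix f) = wedge (f (axis 1 1)) (f (axis 2 1))"
    by (simp add: det_2 matrix_def wedge_def)
  finally show ?thesis .
qed

text \<open>The half widths of the body form a norm on functionals, and an inscribed hexagon of this norm gives three
  strips of half width 1 that contain the body and whose boundary lines touch it.  Their intersection is an affinely regular hexagon
  exactly if the three midlines meet, which is the balance condition on the mid values.  The affine map taking it to the
  standard hexagon multiplies the area of the body by \<open>D\<close> and divides that of the polar by \<open>D\<close>.\<close>

theorem hexagonal_frame_exists:
  fixes K :: "(real ^ 2) set"
  assumes K: "convex_body K"
  shows "\<exists>\<Phi>. affinity \<Phi> \<and> hex_framed (\<Phi> ` K) \<and>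
    measure lebesgue (\<Phi> ` K) * measure lebesgue (half_difference_polar (\<Phi> ` K))
    \<le> measure lebesgue K * measure lebesgue (half_difference_polar K)"
proof -
  interpret plane_norm "half_width K" by (rule plane_norm_half_width[OF K])
  let ?m = "mid_value K"
  have "continuous_on UNIV ?m"
    unfolding mid_value_def
    by (intro continuous_intros continuous_on_compose2[OF continuous_support[OF K]]) auto
  moreover have odd: "?m (- x) = - ?m x" for x by (simp add: mid_value_def field_simps)
  ultimately obtain u v where uv: "third_vertex u v" and m: "?m u + ?m (v - u) = ?m v"
    using balanced_hexagon_exists by blast
  define D where "D = wedge u v"
  have D: "D > 0" using third_vertex_wedge_pos[OF uv] by (simp add: D_def)
  have unit: "half_width K u = 1" "half_width K v = 1" "half_width K (v - u) = 1"
    using uv by (auto simp: third_vertex_def)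
  define f :: "real ^ 2 \<Rightarrow> real ^ 2" where "f k = vector [(u - v) \<bullet> k, v \<bullet> k]" for k
  \<comment> \<open>Chosen so that the normals 0, 1 and 2 of the hexagon read off the functionals \<open>u\<close>, \<open>v\<close> and \<open>v - u\<close>, each
     shifted by its mid value.\<close>
  define \<Phi> where "\<Phi> k = f k + - vector [?m u - ?m v, ?m v]" for k
  have lin: "linear f" by (intro linearI) (auto simp: f_def vec2_eq_iff inner_add_right)
  have wf: "wedge (f (axis 1 1)) (f (axis 2 1)) = D"
    by (simp add: f_def wedge_def inner_axis D_def algebra_simps)
  have inj: "inj f"
  proof (rule linear_injective_0[OF lin, THEN iffD2], intro allI impI)
    fix z assume "f z = 0"
    then have "u \<bullet> z = 0" "v \<bullet> z = 0" by (auto simp: f_def vec2_eq_iff inner_diff_left)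
    then have "z$1 * D = 0" "z$2 * D = 0"
      by (simp_all add: inner_vec2 D_def wedge_def) algebra+
    then show "z = 0" using D by (simp add: vec2_eq_iff)
  qed
  then have "bij f" using linear_injective_imp_surjective[OF lin] by (simp add: bij_def)
  then have aff: "affinity \<Phi>" unfolding affinity_def \<Phi>_def using lin by blast
  have image: "\<Phi> ` K = (+) (- vector [?m u - ?m v, ?m v]) ` f ` K"
    by (auto simp: \<Phi>_def image_image add.commute)
  have body: "convex_body (\<Phi> ` K)"
    using convex_body_linear_image[OF K lin inj]
    unfolding image convex_body_def
    by (simp only: interior_translation image_is_empty) (blast intro: compact_translation convex_translation)
  have ranges: "(\<forall>k\<in>K. \<bar>\<xi> \<bullet> k - ?m \<xi>\<bar> \<le> 1) \<and> (\<exists>k\<in>K. \<xi> \<bullet> k - ?m \<xi> = 1) \<and> (\<exists>k\<in>K. \<xi> \<bullet> k - ?m \<xi> = - 1)"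
    if "half_width K \<xi> = 1" for \<xi>
  proof -
    have h: "support K \<xi> = ?m \<xi> + 1" "support K (- \<xi>) = 1 - ?m \<xi>"
      using that by (simp_all add: half_width_def mid_value_def field_simps)
    have "\<bar>\<xi> \<bullet> k - ?m \<xi>\<bar> \<le> 1" if "k \<in> K" for k
      using support_upper[OF K that, of \<xi>] support_upper[OF K that, of "- \<xi>"] h by simp
    moreover have "\<exists>k\<in>K. \<xi> \<bullet> k - ?m \<xi> = 1"
      using support_attained[OF K, of \<xi>] h by force
    moreover have "\<exists>k\<in>K. \<xi> \<bullet> k - ?m \<xi> = - 1"
      using support_attained[OF K, of "- \<xi>"] h by force
    ultimately show ?thesis by blast
  qed
  have coord: "hex_normal 0 \<bullet> \<Phi> k = u \<bullet> k - ?m u" "hex_normal 1 \<bullet> \<Phi> k = v \<bullet> k - ?m v"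
    "hex_normal 2 \<bullet> \<Phi> k = (v - u) \<bullet> k - ?m (v - u)" for k
    using m by (simp_all add: \<Phi>_def f_def inner_vec2 algebra_simps eval_nat_numeral)
  define touches where "touches n \<longleftrightarrow> (\<forall>k\<in>K. \<bar>n \<bullet> \<Phi> k\<bar> \<le> 1) \<and> (\<exists>k\<in>K. n \<bullet> \<Phi> k = 1) \<and> (\<exists>k\<in>K. n \<bullet> \<Phi> k = - 1)" for n
  have "touches (hex_normal i)" for i
  proof (rule hex_normal_all)
    show "touches (hex_normal 0)" "touches (hex_normal 1)" "touches (hex_normal 2)"
      unfolding touches_def coord using ranges unit by blast+
    show "touches (- n)" if "touches n" for n
    proof -
      have "(- n) \<bullet> z = 1 \<longleftrightarrow> n \<bullet> z = - 1" "(- n) \<bullet> z = - 1 \<longleftrightarrow> n \<bullet> z = 1" for z :: "real ^ 2" by auto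
      then show ?thesis using that by (simp add: touches_def)
    qed
  qed
  then have framed: "hex_framed (\<Phi> ` K)"
    using body unfolding hex_framed_def touches_def by (auto simp: abs_le_iff)
  let ?S = "half_difference_polar K"
  let ?S' = "half_difference_polar (\<Phi> ` K)"
  have "K \<in> lmeasurable" using K by (simp add: convex_body_def lmeasurable_compact)
  from measure_affine_image[OF this lin] have "measure lebesgue (\<Phi> ` K) = D * measure lebesgue K"
    unfolding \<Phi>_def wf using D by (simp only: abs_of_pos)
  moreover have "D * measure lebesgue ?S' \<le> measure lebesgue ?S"
  proof -
    \<comment> \<open>The adjoint of the linear part of \<open>\<Phi>\<close>.\<close>
    define \<Psi> where "\<Psi> \<xi> = \<xi>$1 *\<^sub>R (u - v) + \<xi>$2 *\<^sub>R v" for \<xi> :: "real ^ 2"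
    have lin\<Psi>: "linear \<Psi>" by (intro linearI) (auto simp: \<Psi>_def algebra_simps)
    have w\<Psi>: "wedge (\<Psi> (axis 1 1)) (\<Psi> (axis 2 1)) = D"
      by (simp add: \<Psi>_def D_def axis_def wedge_algebra)
    have "\<xi> \<bullet> \<Phi> k - \<xi> \<bullet> \<Phi> k' = \<Psi> \<xi> \<bullet> k - \<Psi> \<xi> \<bullet> k'" for \<xi> k k'
      by (simp add: \<Phi>_def \<Psi>_def f_def inner_vec2 algebra_simps)
    then have sub: "\<Psi> ` ?S' \<subseteq> ?S" by auto
    have S: "?S \<in> lmeasurable" "?S' \<in> lmeasurable"
      using polar_difference_measurable(1)[OF K] polar_difference_measurable(1)[OF body] .
    have "D * measure lebesgue ?S' = measure lebesgue (\<Psi> ` ?S')"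
      using measure_affine_image[OF S(2) lin\<Psi>, of 0] w\<Psi> D by simp
    also have "\<dots> \<le> measure lebesgue ?S"
      using sub S measurable_linear_image[OF lin\<Psi> S(2)] by (intro measure_mono_fmeasurable) (auto simp: fmeasurableD)
    finally show ?thesis .
  qed
  then have "measure lebesgue K * (D * measure lebesgue ?S') \<le> measure lebesgue K * measure lebesgue ?S"
    by (rule mult_left_mono) simp
  ultimately show ?thesis using aff framed by (intro exI[of _ \<Phi>]) (simp add: algebra_simps)
qed

text \<open>In a triangle of largest area with vertices in the body all points of the body have barycentric
  coordinates of absolute value at most 1.\<close>

lemma bm_ratio_four:
  fixes K :: "(real ^ 2) set"
  assumes K: "convex_body K" and abc: "\<not> collinear {a, b, c :: real ^ 2}"
  shows "4 \<in> bm_ratios K (convex hull {a, b, c})"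
proof -
  let ?F = "\<lambda>p. \<bar>wedge (fst (snd p) - fst p) (snd (snd p) - fst p)\<bar>"
  have cb: "compact K" "convex K" "closed K" using K by (auto simp: convex_body_def compact_imp_closed)
  obtain o' r where r: "r > 0" "cball o' r \<subseteq> K"
    using K mem_interior_cball unfolding convex_body_def by blast
  have pts: "o' \<in> K" "o' + r *\<^sub>R axis 1 1 \<in> K" "o' + r *\<^sub>R axis 2 1 \<in> K"
    using r by (auto simp: dist_norm intro!: subsetD[OF r(2)])
  have "continuous_on (K \<times> K \<times> K) ?F" unfolding wedge_def by (intro continuous_intros)
  moreover have "compact (K \<times> K \<times> K)" "K \<times> K \<times> K \<noteq> {}" using cb pts by (auto intro: compact_Times)
  ultimately obtain p where p: "p \<in> K \<times> K \<times> K" "\<And>q. q \<in> K \<times> K \<times> K \<Longrightarrow> ?F q \<le> ?F p"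
    using continuous_attains_sup[of "K \<times> K \<times> K" ?F] by blast
  obtain V1 V2 V3 where V: "p = (V1, V2, V3)" "V1 \<in> K" "V2 \<in> K" "V3 \<in> K"
    using p(1) by (cases p) auto
  define W where "W = wedge (V2 - V1) (V3 - V1)"
  have max: "\<bar>wedge (y - x) (z - x)\<bar> \<le> \<bar>W\<bar>" if "x \<in> K" "y \<in> K" "z \<in> K" for x y z
    using p(2)[of "(x, y, z)"] that by (simp add: V W_def)
  have "wedge (r *\<^sub>R axis 1 1) (r *\<^sub>R axis 2 1) = r * r" by (simp add: wedge_def axis_def)
  then have W: "W \<noteq> 0" using max[OF pts] mult_pos_pos[OF r(1) r(1)] by auto
  have outer: "\<exists>b1 b2 b3. b1 + b2 + b3 = 1 \<and> - 1 \<le> b1 \<and> - 1 \<le> b2 \<and> - 1 \<le> b3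
      \<and> x = b1 *\<^sub>R V1 + b2 *\<^sub>R V2 + b3 *\<^sub>R V3" if x: "x \<in> K" for x
  proof (intro exI conjI)
    let ?b1 = "wedge (V2 - x) (V3 - x) / W" and ?b2 = "wedge (V3 - x) (V1 - x) / W"
    let ?b3 = "wedge (V1 - x) (V2 - x) / W"
    have ge: "- 1 \<le> b / W" if "\<bar>b\<bar> \<le> \<bar>W\<bar>" for b
    proof -
      have "\<bar>b / W\<bar> \<le> 1" using that W by simp
      then show ?thesis by linarith
    qed
    show "- 1 \<le> ?b1" "- 1 \<le> ?b2" "- 1 \<le> ?b3" using max x V by (auto intro!: ge)
    show "?b1 + ?b2 + ?b3 = 1"
      using W by (simp add: add_divide_distrib[symmetric]) (simp add: W_def wedge_def algebra_simps)
    have "W *\<^sub>R x = wedge (V2 - x) (V3 - x) *\<^sub>R V1 + wedge (V3 - x) (V1 - x) *\<^sub>R V2 + wedge (V1 - x) (V2 - x) *\<^sub>R V3"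
      by (simp add: W_def vec2_eq_iff wedge_def algebra_simps)
    then have "(1 / W) *\<^sub>R (W *\<^sub>R x) = ?b1 *\<^sub>R V1 + ?b2 *\<^sub>R V2 + ?b3 *\<^sub>R V3"
      by (simp only: scaleR_add_right scaleR_scaleR) simp
    then show "x = ?b1 *\<^sub>R V1 + ?b2 *\<^sub>R V2 + ?b3 *\<^sub>R V3" using W by simp
  qed
  have "(1 + 1 + 1 + 1) / (1 - 6 * 0) \<in> bm_ratios K (convex hull {a, b, c})"
    by (rule bm_ratios_barycentric[OF cb(2,3) abc, of V2 V1 V3 0 1 1 1 1 0 0 0 1 0 0 0 1])
      (use W V outer in \<open>auto simp: W_def\<close>)
  then show ?thesis by simp
qed

theorem theorem6:
  fixes K :: "(real ^ 2) set" and a b c :: "real ^ 2" and \<epsilon> :: real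
  assumes "convex_body K"
    and "\<epsilon> > 0"
    and "measure lebesgue K * measure lebesgue (polar_body ((*\<^sub>R) (1/2) ` difference_body K))
           \<le> (1 + \<epsilon>) * 6"
    and "\<not> collinear {a, b, c}"
  shows "banach_mazur K (convex hull {a, b, c}) \<le> 1 + 87 * \<epsilon>"
proof (cases "\<epsilon> < 1 / 29")
  \<comment> \<open>From \<open>\<epsilon> = 1 / 29\<close> on, the bound is at least 4, which holds for every convex body.\<close>
  case True
  obtain \<Phi> where \<Phi>: "affinity \<Phi>" "hex_framed (\<Phi> ` K)"
    "measure lebesgue (\<Phi> ` K) * measure lebesgue (half_difference_polar (\<Phi> ` K))
    \<le> measure lebesgue K * measure lebesgue (half_difference_polar K)"
    using hexagonal_frame_exists[OF assms(1)] by blast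
  have "measure lebesgue (\<Phi> ` K) * measure lebesgue (half_difference_polar (\<Phi> ` K)) \<le> (1 + \<epsilon>) * 6"
    using order_trans[OF \<Phi>(3) assms(3)[unfolded polar_body_difference]] .
  then obtain r where "r \<in> bm_ratios (\<Phi> ` K) (convex hull {a, b, c})" "r \<le> 1 + 87 * \<epsilon>"
    using framed_stability[OF \<Phi>(2) assms(4,2) True] by blast
  then show ?thesis
    using bm_ratios_affinity_image[OF \<Phi>(1)] banach_mazur_le by (meson order_trans subsetD)
next
  case False
  have "banach_mazur K (convex hull {a, b, c}) \<le> 4"
    using bm_ratio_four[OF assms(1,4)] by (rule banach_mazur_le)
  then show ?thesis using False by simp
qed

end
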